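(* Let $s\in(0,1)$, $N\ge 2$, and let $\Omega\subset\mathbb{R}^N$ be open and bounded such that for every $(x_1,\dots,x_N)\in\Omega$ and all $t,\tau\in[-1,1]$ we have $(tx_1,x_2,\dots,x_{N-1},\tau x_N)\in\Omega$. Let $f\in C(\Omega\times\mathbb{R})$ satisfy: (i) for every bounded set $K\subset\mathbb{R}$ there is $L=L(K)>0$ such that $\sup_{x\in\Omega}|f(x,a)-f(x,b)|\le L|a-b|$ for all $a,b\in K$; (ii) for every $a\in\mathbb{R}$, $x=(x_1,\dots,x_N)\in\Omega$ and $t\in[-1,1]$ we have $f((tx_1,x_2,\dots,x_N),a)\ge f(x,a)$. Let $u\in\mathcal{H}^s_0(\Omega)$ be a continuous bounded weak solution of $$(-\Delta)^su=f(x,u)\ \text{ in }\Omega,\qquad u=0\ \text{ in }\mathbb{R}^N\setminus\Omega,$$ which is antisymmetric with respect to $H_{N,0}$, and such that $u\ge 0$ in $H_{N,0}\cap\Omega$. Then $u$ is symmetric with respect to $H_{1,0}$, and either $u\equiv 0$ in $\Omega$ or $u|_{\Omega\cap H_{1,0}\cap H_{N,0}}$ is strictly decreasing in $x_1$, that is, for all $x,y\in\Omega\cap H_{1,0}\cap H_{N,0}$ with $x_i=y_i$ for $i=2,\dots,N$ and $x_1<y_1$ we have $u(x)>u(y)$.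
   Context: Let $c_{N,s}>0$ be the normalization constant of the fractional Laplacian, $(-\Delta)^s\phi(x)=\frac{c_{N,s}}{2}\int_{\mathbb{R}^N}\frac{2\phi(x)-\phi(x+y)-\phi(x-y)}{|y|^{N+2s}}\,dy$ for $\phi\in C_c^\infty(\mathbb{R}^N)$. The associated bilinear form is $$\mathcal{E}_s(u,v)=\frac{c_{N,s}}{2}\int_{\mathbb{R}^N}\int_{\mathbb{R}^N}\frac{(u(x)-u(y))(v(x)-v(y))}{|x-y|^{N+2s}}\,dx\,dy,$$ $H^s(\mathbb{R}^N)=\{u\in L^2(\mathbb{R}^N): \mathcal{E}_s(u,u)<\infty\}$ and $\mathcal{H}^s_0(\Omega)=\{v\in H^s(\mathbb{R}^N): v=0\text{ on }\mathbb{R}^N\setminus\Omega\}$. A function $u\in\mathcal{H}^s_0(\Omega)$ is a weak solution of $(-\Delta)^su=f(x,u)$ in $\Omega$, $u=0$ in $\mathbb{R}^N\setminus\Omega$, if $\mathcal{E}_s(u,v)=\int_\Omega f(x,u(x))v(x)\,dx$ for all $v\in\mathcal{H}^s_0(\Omega)$ (whenever the right-hand side exists). For $i\in\{1,\dots,N\}$ and $\lambda\in\mathbb{R}$, $H_{i,\lambda}=\{x\in\mathbb{R}^N: x_i>\lambda\}$ and $r_{i,\lambda}(x)=x+2(\lambda-x_i)e_i$ is the reflection at $\partial H_{i,\lambda}$, where $e_i$ is the $i$-th standard unit vector. A function $u:\mathbb{R}^N\to\mathbb{R}$ is symmetric with respect to $H_{i,\lambda}$ if $u\circ r_{i,\lambda}=u$,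 and antisymmetric with respect to $H_{i,\lambda}$ if $u\circ r_{i,\lambda}=-u$. *)

theory Defs
  imports "HOL-Analysis.Analysis"
begin

text \<open>
  Functions on \<open>\<real>\<^sup>N\<close> are functions on \<^typ>\<open>real ^ 'n\<close> with \<open>N = CARD('n)\<close>.
\<close>

text \<open>
  The constant \<open>c\<^sub>N\<^sub>,\<^sub>s\<close> for which \<open>(-\<Delta>)\<^sup>s\<close> has the Fourier symbol \<open>|\<xi>|\<^sup>2\<^sup>s\<close>.
\<close>

definition frac_const :: "nat \<Rightarrow> real \<Rightarrow> real" where
  "frac_const N s =
     s * 4 powr s * Gamma (real N / 2 + s) / (pi powr (real N / 2) * Gamma (1 - s))"

text \<open>
  The double integral is taken with respect to Lebesgue measure on the product space. On the
  diagonal, a null set, the integrand takes the value 0 because of \<open>0 powr a = 0\<close> and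
  \<open>a / 0 = 0\<close>.
\<close>

definition frac_integrand ::
  "real \<Rightarrow> (real ^ 'n \<Rightarrow> real) \<Rightarrow> (real ^ 'n \<Rightarrow> real) \<Rightarrow> (real ^ 'n) \<times> (real ^ 'n) \<Rightarrow> real" where
  "frac_integrand s u v = (\<lambda>(x, y).
     (u x - u y) * (v x - v y) / norm (x - y) powr (real CARD('n) + 2 * s))"

definition frac_form :: "real \<Rightarrow> (real ^ 'n \<Rightarrow> real) \<Rightarrow> (real ^ 'n \<Rightarrow> real) \<Rightarrow> real" where
  "frac_form s u v = frac_const CARD('n) s / 2 * (LINT p|lebesgue. frac_integrand s u v p)"

text \<open>
  The Bochner integral of a non-integrable function is 0, so finiteness of the energy
  \<open>frac_form s u u\<close> has to be expressed by integrability of its (nonnegative) integrand.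
\<close>

definition frac_sobolev :: "real \<Rightarrow> (real ^ 'n \<Rightarrow> real) set" where
  "frac_sobolev s = {u. u \<in> borel_measurable lebesgue \<and>
     integrable lebesgue (\<lambda>x. (u x)\<^sup>2) \<and> integrable lebesgue (frac_integrand s u u)}"

definition frac_sobolev0 :: "real \<Rightarrow> (real ^ 'n) set \<Rightarrow> (real ^ 'n \<Rightarrow> real) set" where
  "frac_sobolev0 s \<Omega> = {v \<in> frac_sobolev s. \<forall>x. x \<notin> \<Omega> \<longrightarrow> v x = 0}"

text \<open>
  The nonlinearity need not be bounded on the domain, so the equation is required exactly for
  those test functions for which the right-hand side exists as a Lebesgue integral.
\<close>

definition weak_solution ::
  "real \<Rightarrow> (real ^ 'n) set \<Rightarrow> (real ^ 'n \<Rightarrow> real \<Rightarrow> real) \<Rightarrow> (real ^ 'n \<Rightarrow> real) \<Rightarrow> bool" where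
  "weak_solution s \<Omega> f u \<longleftrightarrow> u \<in> frac_sobolev0 s \<Omega> \<and>
     (\<forall>v \<in> frac_sobolev0 s \<Omega>. set_integrable lebesgue \<Omega> (\<lambda>x. f x (u x) * v x) \<longrightarrow>
        frac_form s u v = (LINT x:\<Omega>|lebesgue. f x (u x) * v x))"

definition half_space :: "'n \<Rightarrow> real \<Rightarrow> (real ^ 'n) set" where
  "half_space i l = {x. x $ i > l}"

definition reflect :: "'n \<Rightarrow> real \<Rightarrow> real ^ 'n \<Rightarrow> real ^ 'n" where
  "reflect i l x = x + (2 * (l - x $ i)) *\<^sub>R axis i 1"

text \<open>Symmetry and antisymmetry with respect to \<open>half_space i l\<close>.\<close>

definition symmetric_wrt :: "'n \<Rightarrow> real \<Rightarrow> (real ^ 'n \<Rightarrow> real) \<Rightarrow> bool" where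
  "symmetric_wrt i l u \<longleftrightarrow> u \<circ> reflect i l = u"

definition antisymmetric_wrt :: "'n \<Rightarrow> real \<Rightarrow> (real ^ 'n \<Rightarrow> real) \<Rightarrow> bool" where
  "antisymmetric_wrt i l u \<longleftrightarrow> u \<circ> reflect i l = (\<lambda>x. - u x)"

text \<open>Multiplication of the \<open>i\<close>-th coordinate by \<open>t\<close>, all others being kept.\<close>

definition scale_coord :: "'n \<Rightarrow> real \<Rightarrow> real ^ 'n \<Rightarrow> real ^ 'n" where
  "scale_coord i t x = (\<chi> j. if j = i then t * x $ j else x $ j)"

end

(* Moving planes in the direction x_1, for w_l = u o r_(1,l) - u, which is antisymmetric with
   respect to both x_1 = l and x_N = 0. Folding the kernel |x-y|^(-N-2s) onto the quarter space
   Q = {x_1 > l, x_N > 0} with these signs leaves a positive kernel, by strict convexity of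
   t |-> t^(-N/2-s). Testing the equation with the negative part of w_l on Q therefore gives a maximum
   principle on sets of small measure, and testing it with the negative part of w_l minus a small
   odd bump gives a strong maximum principle. If w_l vanished identically for some l > 0, then u
   would vanish near one end of the domain, so that planes moving in from that end would stop
   at once at a second parallel plane of symmetry and u would be periodic. *)

theory Submission
  imports Defs
begin

section \<open>Reflections and Lebesgue measure\<close>

text \<open>Since u changes sign, w_l is known to be nonnegative outside \<Omega> only where x_N
  \<ge> 0, so a maximum principle for functions odd in x_1 alone does not apply to it; this is why
  both mirrors are folded at once. Cutting w_l off along the boundary of Q could destroy finite
  energy, and it is again the double oddness that prevents this, by a bound that treats all s alike.
  As f(x, u(x)) may be unbounded near the boundary of \<Omega>, test functions must have compact
  support in \<Omega>; the negative part is therefore lowered by some \<epsilon> > 0, and the error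
  is beaten by taking \<epsilon> small. The strong maximum principle rests on a term linear in the
  integral of the test function v, its interaction with a distant ball on which w_l is positive.
  Since the kernel links any two points of Q, a zero of w_l in \<Omega> forces w_l = 0 on all of Q
  even if \<Omega> is disconnected. Symmetry comes from a second solution: condition (ii) with t =
  -1, used in both directions, makes f even in x_1, so the mirror image of u solves the same problem
  and planes may arrive from either side.\<close>

lemma reflect_nth: "reflect i l x $ j = (if j = i then 2 * l - x $ i else x $ j)"
  by (simp add: reflect_def axis_def)

lemma reflect_reflect [simp]: "reflect i l (reflect i l x) = x"
  by (simp add: vec_eq_iff reflect_nth)

lemma reflect_commute: "i \<noteq> j \<Longrightarrow> reflect i l (reflect j m x) = reflect j m (reflect i l x)"
  by (simp add: vec_eq_iff reflect_nth)

text \<open>For squared distances a reflection of one point only adds a product of signed distances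
  to the mirror. Its sign tells whether the two points lie on the same side, and the terms of two
  orthogonal mirrors add independently.\<close>

lemma norm_diff_reflect_sq:
  "(norm (x - reflect i l y))\<^sup>2 = (norm (x - y))\<^sup>2 + 4 * ((x $ i - l) * (y $ i - l))"
proof -
  define k where "k = 2 * (l - y $ i)"
  have "x - reflect i l y = (x - y) - k *\<^sub>R axis i 1"
    by (simp add: reflect_def k_def)
  moreover have "(norm (d - k *\<^sub>R axis i 1))\<^sup>2 = (norm d)\<^sup>2 - 2 * k * (d $ i) + k\<^sup>2" for d
    unfolding power2_norm_eq_inner
    by (simp add: inner_diff_left inner_diff_right inner_axis inner_axis' power2_eq_square
        right_diff_distrib)
  ultimately have "(norm (x - reflect i l y))\<^sup>2 = (norm (x - y))\<^sup>2 - 2 * k * (x $ i - y $ i) + k\<^sup>2"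
    by (simp only: vector_minus_component)
  then show ?thesis by (simp add: k_def power2_eq_square algebra_simps)
qed

lemma norm_reflect_diff_reflect: "norm (reflect i l x - reflect i l y) = norm (x - y)"
proof -
  have "(norm (reflect i l x - reflect i l y))\<^sup>2 = (norm (x - y))\<^sup>2"
    using norm_diff_reflect_sq[of "reflect i l x" i l y] norm_diff_reflect_sq[of y i l x]
    by (simp add: reflect_nth norm_minus_commute algebra_simps)
  then show ?thesis by simp
qed

lemma norm_reflect_diff: "norm (reflect i l x - y) = norm (x - reflect i l y)"
  using norm_reflect_diff_reflect[of i l x "reflect i l y"] by simp

lemma continuous_on_reflect [continuous_intros]:
  "continuous_on S g \<Longrightarrow> continuous_on S (\<lambda>x. reflect i l (g x))"
  unfolding reflect_def by (intro continuous_intros)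

lemma measurable_reflect [measurable]: "reflect i l \<in> borel_measurable borel"
  using continuous_on_reflect[OF continuous_on_id, of UNIV i l]
  by (intro borel_measurable_continuous_onI) simp

text \<open>A reflection is a diagonal affine map whose only entry different from 1 is -1, so the
  affine change of variables has Jacobian 1.\<close>

lemma distr_lborel_reflect: "distr lborel borel (reflect i l) = (lborel :: (real ^ 'n) measure)"
proof -
  define c :: "real ^ 'n \<Rightarrow> real" where "c j = (if j = axis i 1 then -1 else 1)" for j
  have c: "c j \<noteq> 0" "\<bar>c j\<bar> = 1" for j by (auto simp: c_def)
  have "reflect i l x = (2 * l) *\<^sub>R axis i 1 + (\<Sum>j\<in>Basis. (c j * (x \<bullet> j)) *\<^sub>R j)" for x
  proof -
    have "(\<Sum>j\<in>Basis. (c j * (x \<bullet> j)) *\<^sub>R j)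
      = (\<Sum>j\<in>Basis. (x \<bullet> j) *\<^sub>R j - (if j = axis i 1 then (2 * (x \<bullet> j)) *\<^sub>R j else 0))"
      by (intro sum.cong) (auto simp: c_def scaleR_left_diff_distrib[symmetric])
    also have "\<dots> = x - (2 * x $ i) *\<^sub>R axis i 1"
      by (simp add: sum_subtractf euclidean_representation axis_in_Basis_iff inner_axis)
    finally show ?thesis by (simp add: reflect_def algebra_simps)
  qed
  then have "reflect i l = (\<lambda>x. (2 * l) *\<^sub>R axis i 1 + (\<Sum>j\<in>Basis. (c j * (x \<bullet> j)) *\<^sub>R j))"
    by blast
  with lborel_affine_euclidean[of c "(2 * l) *\<^sub>R axis i 1"] c show ?thesis
    by (simp add: density_1)
qed

lemma integral_lborel_reflect:
  fixes g :: "real ^ 'n \<Rightarrow> real"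
  assumes "g \<in> borel_measurable borel"
  shows "(\<integral>x. g (reflect i l x) \<partial>lborel) = (\<integral>x. g x \<partial>lborel)"
    and "integrable lborel (\<lambda>x. g (reflect i l x)) \<longleftrightarrow> integrable lborel g"
  using integral_distr[of "reflect i l" lborel borel g] integrable_distr_eq[of "reflect i l" lborel borel g]
    assms by (auto simp: distr_lborel_reflect)

section \<open>Measure-preserving maps of the product space\<close>

lemma distr_lborel_pair_left:
  assumes "distr lborel borel T = (lborel :: 'a::euclidean_space measure)"
    and [measurable]: "T \<in> borel_measurable borel"
  shows "distr lborel borel (\<lambda>(x, y). (T x, y)) = (lborel :: ('a \<times> 'b::euclidean_space) measure)"
proof -
  have "lborel = distr lborel borel T \<Otimes>\<^sub>M distr (lborel :: 'b measure) borel (\<lambda>x. x)"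
    by (simp add: assms(1) lborel_prod distr_id2)
  also have "\<dots> = distr (lborel \<Otimes>\<^sub>M lborel) (borel \<Otimes>\<^sub>M borel) (\<lambda>(x, y). (T x, y))"
    by (rule pair_measure_distr) (auto simp: distr_id2 sigma_finite_lborel)
  finally show ?thesis by (simp add: lborel_prod borel_prod)
qed

lemma distr_lborel_swap:
  "distr lborel borel (\<lambda>(x, y). (y, x)) = (lborel :: ('a::euclidean_space \<times> 'b::euclidean_space) measure)"
proof -
  have "(lborel :: ('a \<times> 'b) measure) = distr lborel (lborel \<Otimes>\<^sub>M lborel) (\<lambda>(x, y). (y, x))"
    using lborel_pair.distr_pair_swap[where 'a='a and 'b='b] by (simp only: lborel_prod)
  also have "\<dots> = distr lborel borel (\<lambda>(x, y). (y, x))"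
    by (rule distr_cong) (simp_all only: lborel_prod sets_lborel)
  finally show ?thesis by simp
qed

lemma integral_lborel_distr:
  fixes g :: "'a::euclidean_space \<Rightarrow> real"
  assumes "distr lborel borel T = (lborel :: 'a measure)" "T \<in> borel_measurable borel"
   "g \<in> borel_measurable borel"
  shows "(\<integral>x. g (T x) \<partial>lborel) = (\<integral>x. g x \<partial>lborel)"
    and "integrable lborel (\<lambda>x. g (T x)) \<longleftrightarrow> integrable lborel g"
  using integral_distr[of T lborel borel g] integrable_distr_eq[of T lborel borel g]
    assms by auto

section \<open>The kernel and the energy space\<close>

definition kern :: "real \<Rightarrow> real ^ 'n \<Rightarrow> real" where
  "kern s z = 1 / norm z powr (real CARD('n) + 2 * s)"

lemma kern_nonneg [simp]: "0 \<le> kern s z"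
  by (simp add: kern_def)

lemma kern_cong: "norm (z :: real ^ 'n) = norm (z' :: real ^ 'n) \<Longrightarrow> kern s z = kern s z'"
  by (simp add: kern_def)

lemma kern_minus [simp]: "kern s (- z) = kern s z"
  by (simp add: kern_def)

lemma kern_minus_commute: "kern s (x - y) = kern s (y - x)"
  by (rule kern_cong) (rule norm_minus_commute)

lemma kern_antimono:
  fixes z z' :: "real ^ 'n"
  assumes "0 < s" "z \<noteq> 0" "norm z \<le> norm z'"
  shows "kern s z' \<le> kern s z"
  unfolding kern_def using assms
  by (intro divide_left_mono powr_mono2 mult_pos_pos) auto

lemma kern_measurable [measurable]: "kern s \<in> borel_measurable borel"
  unfolding kern_def[abs_def] by measurable

lemma continuous_on_kern: "continuous_on (- {0}) (kern s)"
  unfolding kern_def[abs_def] by (intro continuous_intros) auto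

section \<open>The kernel as a convex function of the squared distance\<close>

lemma kern_eq_powr: "kern s (z :: real ^ 'n) = ((norm z)\<^sup>2) powr (- (real CARD('n) / 2 + s))"
proof (cases "z = 0")
  case False
  then have "((norm z)\<^sup>2) powr (- (real CARD('n) / 2 + s)) = norm z powr (2 * (- (real CARD('n) / 2 + s)))"
    by (metis powr_powr norm_ge_zero norm_le_zero_iff of_nat_numeral order_less_le powr_realpow zero_less_norm_iff)
  also have "2 * (- (real CARD('n) / 2 + s)) = - (real CARD('n) + 2 * s)" by simp
  finally show ?thesis unfolding kern_def by (simp only: powr_minus_divide)
qed (simp add: kern_def)

text \<open>Strict convexity of t^(-q) in the form of a positive mixed second difference: the drop
  \<open>h\<close> over a step B shrinks as the base point grows, its derivative being -q times a
  difference of values of a decreasing power.\<close>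

lemma powr_mixed_difference_pos:
  fixes q d A B :: real
  assumes "0 < q" "0 < d" "0 < A" "0 < B"
  shows "(d + A) powr (- q) + (d + B) powr (- q) < d powr (- q) + (d + A + B) powr (- q)"
proof -
  define h where "h t = t powr (- q) - (t + B) powr (- q)" for t
  have "h (d + A) < h d"
  proof (rule DERIV_neg_imp_decreasing[of d "d + A" h])
    fix t assume t: "d \<le> t" "t \<le> d + A"
    have "(t + B) powr (- q - 1) < t powr (- q - 1)"
      using t assms by (intro powr_less_mono2_neg) auto
    then have "(- q) * t powr (- q - 1) - (- q) * (t + B) powr (- q - 1) < 0"
      using assms by (simp add: algebra_simps)
    moreover have "(h has_real_derivative
        (- q) * t powr (- q - 1) - (- q) * (t + B) powr (- q - 1)) (at t)"
      unfolding h_def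
    proof (rule DERIV_diff)
      show "((\<lambda>t. t powr (- q)) has_real_derivative - q * t powr (- q - 1)) (at t)"
        using t assms by (intro has_real_derivative_powr) simp
      show "((\<lambda>t. (t + B) powr (- q)) has_real_derivative - q * (t + B) powr (- q - 1)) (at t)"
        using t assms has_real_derivative_powr[of "t + B" "- q"]
        by (simp add: DERIV_shift[of "\<lambda>t. t powr (- q)"])
    qed
    ultimately show "\<exists>y. (h has_real_derivative y) (at t) \<and> y < 0" by blast
  qed (use assms in simp)
  then show ?thesis by (simp add: h_def)
qed

lemma kern_quad_pos:
  fixes z0 z1 z2 z3 :: "real ^ 'n"
  assumes "0 < s" "z0 \<noteq> 0" "0 < A" "0 < B"
    and "(norm z1)\<^sup>2 = (norm z0)\<^sup>2 + A" "(norm z2)\<^sup>2 = (norm z0)\<^sup>2 + B"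
    and "(norm z3)\<^sup>2 = (norm z0)\<^sup>2 + A + B"
  shows "0 < kern s z0 - kern s z1 - kern s z2 + kern s z3"
  using powr_mixed_difference_pos[of "real CARD('n) / 2 + s" "(norm z0)\<^sup>2" A B] assms
  by (simp add: kern_eq_powr add_nonneg_pos)

text \<open>If a point lies on a mirror, A or B is 0 and the four kernels cancel in pairs; otherwise
  the strict inequality applies.\<close>

lemma kern_quad_nonneg:
  fixes z0 z1 z2 z3 :: "real ^ 'n"
  assumes "0 < s" "z0 \<noteq> 0" "0 \<le> A" "0 \<le> B"
    and "(norm z1)\<^sup>2 = (norm z0)\<^sup>2 + A" "(norm z2)\<^sup>2 = (norm z0)\<^sup>2 + B"
    and "(norm z3)\<^sup>2 = (norm z0)\<^sup>2 + A + B"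
  shows "0 \<le> kern s z0 - kern s z1 - kern s z2 + kern s z3"
proof -
  consider "A = 0" | "B = 0" | "0 < A" "0 < B" using assms by fastforce
  then show ?thesis
  proof cases
    case 3
    then show ?thesis using kern_quad_pos[OF assms(1,2) 3 assms(5-7)] by simp
  qed (use assms in \<open>auto simp: kern_eq_powr\<close>)
qed

section \<open>The energy space and its bilinear form\<close>

lemma frac_integrand_eq: "frac_integrand s u v (x, y) = (u x - u y) * (v x - v y) * kern s (x - y)"
  by (simp add: frac_integrand_def kern_def)

lemma frac_integrand_measurable [measurable]:
  assumes [measurable]: "u \<in> borel_measurable borel" "v \<in> borel_measurable borel"
  shows "frac_integrand s u v \<in> borel_measurable borel"
  unfolding borel_prod[symmetric] frac_integrand_def by measurable

definition frac_bilin :: "real \<Rightarrow> (real ^ 'n \<Rightarrow> real) \<Rightarrow> (real ^ 'n \<Rightarrow> real) \<Rightarrow> real" where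
  "frac_bilin s u v = (\<integral>p. frac_integrand s u v p \<partial>lborel)"

text \<open>Working with Borel representatives makes the completion of the measure disappear.\<close>

definition energy_space :: "real \<Rightarrow> (real ^ 'n \<Rightarrow> real) set" where
  "energy_space s = {u. u \<in> borel_measurable borel \<and>
     integrable lborel (\<lambda>x. (u x)\<^sup>2) \<and> integrable lborel (frac_integrand s u u)}"

lemma energy_spaceD [dest]:
  assumes "u \<in> energy_space s"
  shows "u \<in> borel_measurable borel" "integrable lborel (\<lambda>x. (u x)\<^sup>2)"
    "integrable lborel (frac_integrand s u u)"
  using assms by (auto simp: energy_space_def)

lemma frac_form_eq:
  fixes u v :: "real ^ 'n \<Rightarrow> real"
  assumes "u \<in> borel_measurable borel" "v \<in> borel_measurable borel"
  shows "frac_form s u v = frac_const CARD('n) s / 2 * frac_bilin s u v"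
  unfolding frac_form_def frac_bilin_def
  using frac_integrand_measurable[OF assms] by (simp add: integral_completion)

lemma frac_sobolev_iff_energy_space:
  assumes [measurable]: "u \<in> borel_measurable borel"
  shows "u \<in> frac_sobolev s \<longleftrightarrow> u \<in> energy_space s"
proof -
  have "(\<lambda>x. (u x)\<^sup>2) \<in> borel_measurable lborel" "frac_integrand s u u \<in> borel_measurable lborel"
    by measurable
  moreover have "u \<in> borel_measurable lebesgue"
    using assms by (simp add: measurable_completion)
  ultimately show ?thesis
    by (simp add: frac_sobolev_def energy_space_def integrable_completion assms)
qed

lemma integrable_frac_integrand:
  assumes u: "u \<in> energy_space s" and v: "v \<in> energy_space s"
  shows "integrable lborel (frac_integrand s u v)"
proof (rule Bochner_Integration.integrable_bound)
  show "integrable lborel (\<lambda>p. frac_integrand s u u p + frac_integrand s v v p)"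
    using u v by auto
  show "frac_integrand s u v \<in> borel_measurable lborel"
    using energy_spaceD(1)[OF u] energy_spaceD(1)[OF v] by simp
  have "norm (a * b * k) \<le> norm (a * a * k + b * b * k)" if "0 \<le> k" for a b k :: real
  proof -
    have "\<bar>a * b\<bar> \<le> a * a + b * b"
      using sum_squares_bound[of "\<bar>a\<bar>" "\<bar>b\<bar>"] mult_nonneg_nonneg[of "\<bar>a\<bar>" "\<bar>b\<bar>"]
      by (simp add: abs_mult power2_eq_square del: mult_nonneg_nonneg)
    then have "\<bar>a * b\<bar> * k \<le> (a * a + b * b) * k" using that by (rule mult_right_mono)
    then show ?thesis using that by (simp add: abs_mult algebra_simps)
  qed
  then show "AE p in lborel. norm (frac_integrand s u v p)
      \<le> norm (frac_integrand s u u p + frac_integrand s v v p)"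
    by (auto simp: frac_integrand_eq)
qed

lemma energy_space_scale:
  assumes "u \<in> energy_space s" shows "(\<lambda>x. c * u x) \<in> energy_space s"
proof -
  have "frac_integrand s (\<lambda>x. c * u x) (\<lambda>x. c * u x) = (\<lambda>p. c\<^sup>2 * frac_integrand s u u p)"
    by (auto simp: fun_eq_iff frac_integrand_eq power2_eq_square algebra_simps)
  then show ?thesis using assms by (auto simp: energy_space_def power_mult_distrib)
qed

lemma energy_space_add:
  assumes u: "u \<in> energy_space s" and v: "v \<in> energy_space s"
  shows "(\<lambda>x. u x + v x) \<in> energy_space s"
proof -
  have [measurable]: "u \<in> borel_measurable borel" "v \<in> borel_measurable borel"
    using u v by auto
  have "frac_integrand s (\<lambda>x. u x + v x) (\<lambda>x. u x + v x) =
      (\<lambda>p. frac_integrand s u u p + 2 * frac_integrand s u v p + frac_integrand s v v p)"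
    by (auto simp: fun_eq_iff frac_integrand_eq algebra_simps)
  moreover have "integrable lborel (\<lambda>x. (u x + v x)\<^sup>2)"
  proof (rule Bochner_Integration.integrable_bound)
    show "integrable lborel (\<lambda>x. 2 * (u x)\<^sup>2 + 2 * (v x)\<^sup>2)"
      using energy_spaceD(2)[OF u] energy_spaceD(2)[OF v] by simp
    have "(u x + v x)\<^sup>2 \<le> 2 * (u x)\<^sup>2 + 2 * (v x)\<^sup>2" for x
      using sum_squares_bound[of "u x" "v x"] by (simp add: power2_sum)
    then show "AE x in lborel. norm ((u x + v x)\<^sup>2) \<le> norm (2 * (u x)\<^sup>2 + 2 * (v x)\<^sup>2)"
      by simp
  qed measurable
  ultimately show ?thesis
    using u v integrable_frac_integrand[OF u v] by (auto simp: energy_space_def)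
qed

lemma energy_space_diff:
  assumes "u \<in> energy_space s" "v \<in> energy_space s"
  shows "(\<lambda>x. u x - v x) \<in> energy_space s"
  using energy_space_add[OF assms(1) energy_space_scale[OF assms(2), of "-1"]] by simp

lemma frac_bilin_diff_left:
  assumes "u \<in> energy_space s" "u' \<in> energy_space s" "v \<in> energy_space s"
  shows "frac_bilin s (\<lambda>x. u x - u' x) v = frac_bilin s u v - frac_bilin s u' v"
proof -
  have "frac_integrand s (\<lambda>x. u x - u' x) v = (\<lambda>p. frac_integrand s u v p - frac_integrand s u' v p)"
    by (auto simp: fun_eq_iff frac_integrand_eq algebra_simps)
  then show ?thesis using assms by (simp add: frac_bilin_def integrable_frac_integrand)
qed

lemma frac_bilin_scale_left: "frac_bilin s (\<lambda>x. c * u x) v = c * frac_bilin s u v"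
proof -
  have "frac_integrand s (\<lambda>x. c * u x) v = (\<lambda>p. c * frac_integrand s u v p)"
    by (auto simp: fun_eq_iff frac_integrand_eq algebra_simps)
  then show ?thesis by (simp add: frac_bilin_def)
qed

lemma frac_bilin_self_nonneg: "0 \<le> frac_bilin s v v"
  unfolding frac_bilin_def
  by (intro integral_nonneg_AE AE_I2) (auto simp: frac_integrand_def split: prod.split)

section \<open>Double integrals under reflections\<close>

lemma distr_lborel_reflect_left:
  "distr lborel borel (\<lambda>(x, y). (reflect i l x, y)) = (lborel :: ((real ^ 'n) \<times> (real ^ 'n)) measure)"
  by (intro distr_lborel_pair_left distr_lborel_reflect) measurable

lemma measurable_reflect_left [measurable]:
  "(\<lambda>(x, y). (reflect i l x, y)) \<in> borel \<rightarrow>\<^sub>M (borel :: ((real ^ 'n) \<times> (real ^ 'n)) measure)"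
  unfolding borel_prod[symmetric] by measurable

lemma measurable_swap_borel [measurable]:
  "(\<lambda>(x, y). (y, x)) \<in> borel \<rightarrow>\<^sub>M (borel :: ('a::euclidean_space \<times> 'a) measure)"
  unfolding borel_prod[symmetric] by measurable

lemma integral_reflect_left:
  fixes g :: "(real ^ 'n) \<times> (real ^ 'n) \<Rightarrow> real"
  assumes "g \<in> borel_measurable borel"
  shows "(\<integral>(x, y). g (reflect i l x, y) \<partial>lborel) = (\<integral>p. g p \<partial>lborel)"
    and "integrable lborel (\<lambda>(x, y). g (reflect i l x, y)) \<longleftrightarrow> integrable lborel g"
  using integral_lborel_distr[OF distr_lborel_reflect_left measurable_reflect_left assms, of i l]
  by (simp_all add: case_prod_unfold)

lemma integral_swap:
  fixes g :: "'a::euclidean_space \<times> 'a \<Rightarrow> real"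
  assumes "g \<in> borel_measurable borel"
  shows "(\<integral>(x, y). g (y, x) \<partial>lborel) = (\<integral>p. g p \<partial>lborel)"
    and "integrable lborel (\<lambda>(x, y). g (y, x)) \<longleftrightarrow> integrable lborel g"
  using integral_lborel_distr[OF distr_lborel_swap measurable_swap_borel assms]
  by (simp_all add: case_prod_unfold)

text \<open>Reflecting both variables is composed of reflecting the first, swapping, reflecting the
  first and swapping, each of which preserves the measure.\<close>

lemma integral_reflect_both:
  fixes g :: "(real ^ 'n) \<times> (real ^ 'n) \<Rightarrow> real"
  assumes g [measurable]: "g \<in> borel_measurable borel"
  shows "(\<integral>(x, y). g (reflect i l x, reflect i l y) \<partial>lborel) = (\<integral>p. g p \<partial>lborel)"
    and "integrable lborel (\<lambda>(x, y). g (reflect i l x, reflect i l y)) \<longleftrightarrow> integrable lborel g"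
proof -
  define h where "h = (\<lambda>(x, y). g (reflect i l x, y))"
  have h [measurable]: "h \<in> borel_measurable borel"
    using measurable_compose[OF measurable_reflect_left g, of i l] by (simp add: h_def case_prod_unfold)
  define k where "k = (\<lambda>(x, y). h (y, x))"
  have k [measurable]: "k \<in> borel_measurable borel"
    using measurable_compose[OF measurable_swap_borel h] by (simp add: k_def case_prod_unfold)
  define m where "m = (\<lambda>(x, y). k (reflect i l x, y))"
  have m [measurable]: "m \<in> borel_measurable borel"
    using measurable_compose[OF measurable_reflect_left k, of i l] by (simp add: m_def case_prod_unfold)
  have eq: "(\<lambda>(x, y). g (reflect i l x, reflect i l y)) = (\<lambda>(x, y). m (y, x))"
    by (auto simp: m_def k_def h_def)
  show "(\<integral>(x, y). g (reflect i l x, reflect i l y) \<partial>lborel) = (\<integral>p. g p \<partial>lborel)"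
    unfolding eq integral_swap(1)[OF m]
    using integral_reflect_left(1)[OF k, of i l] integral_swap(1)[OF h] integral_reflect_left(1)[OF g, of i l]
    by (simp flip: m_def k_def h_def)
  show "integrable lborel (\<lambda>(x, y). g (reflect i l x, reflect i l y)) \<longleftrightarrow> integrable lborel g"
    unfolding eq integral_swap(2)[OF m]
    using integral_reflect_left(2)[OF k, of i l] integral_swap(2)[OF h] integral_reflect_left(2)[OF g, of i l]
    by (simp flip: m_def k_def h_def)
qed

lemma frac_integrand_reflect:
  "frac_integrand s (\<lambda>x. u (reflect i l x)) v (x, y)
    = frac_integrand s u (\<lambda>x. v (reflect i l x)) (reflect i l x, reflect i l y)"
  using norm_reflect_diff_reflect[of i l x y] by (simp add: frac_integrand_eq kern_def)

text \<open>Reflecting both variables leaves the kernel unchanged, so a reflection passes from one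
  argument to the other. In this way the equation for u tested with a reflected function becomes an
  equation for the reflected u.\<close>

lemma frac_bilin_reflect:
  assumes [measurable]: "u \<in> borel_measurable borel" "v \<in> borel_measurable borel"
  shows "frac_bilin s (\<lambda>x. u (reflect i l x)) v = frac_bilin s u (\<lambda>x. v (reflect i l x))"
proof -
  have "frac_bilin s (\<lambda>x. u (reflect i l x)) v
    = (\<integral>(x, y). frac_integrand s u (\<lambda>x. v (reflect i l x)) (reflect i l x, reflect i l y) \<partial>lborel)"
    unfolding frac_bilin_def
    by (intro Bochner_Integration.integral_cong refl) (simp only: frac_integrand_reflect split_paired_all case_prod_conv)
  also have "\<dots> = frac_bilin s u (\<lambda>x. v (reflect i l x))"
    unfolding frac_bilin_def by (rule integral_reflect_both) measurable
  finally show ?thesis .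
qed

lemma energy_space_reflect:
  assumes u: "u \<in> energy_space s"
  shows "(\<lambda>x. u (reflect i l x)) \<in> energy_space s"
proof -
  have [measurable]: "u \<in> borel_measurable borel" using u by auto
  have "frac_integrand s (\<lambda>x. u (reflect i l x)) (\<lambda>x. u (reflect i l x))
    = (\<lambda>(x, y). frac_integrand s u u (reflect i l x, reflect i l y))"
    by (auto simp: fun_eq_iff frac_integrand_reflect)
  moreover have "frac_integrand s u u \<in> borel_measurable borel" by measurable
  moreover have "integrable lborel (\<lambda>x. (u (reflect i l x))\<^sup>2)"
    using u by (subst integral_lborel_reflect(2)[of "\<lambda>x. (u x)\<^sup>2"]) auto
  ultimately show ?thesis
    using u by (auto simp: energy_space_def integral_reflect_both)
qed

section \<open>Doubly antisymmetric functions\<close>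

text \<open>Used for the product minorant \<open>k0 * indicator B x * neg \<epsilon> W y\<close> of
  the folded interaction, whose double integral has to be evaluated.\<close>

lemma integral_tensor:
  fixes f :: "'a::euclidean_space \<Rightarrow> real" and g :: "'b::euclidean_space \<Rightarrow> real"
  assumes f: "integrable lborel f" and g: "integrable lborel g"
  shows "integrable lborel (\<lambda>(x, y). f x * g y)"
    and "(\<integral>(x, y). f x * g y \<partial>lborel) = (\<integral>x. f x \<partial>lborel) * (\<integral>y. g y \<partial>lborel)"
proof -
  have [measurable]: "f \<in> borel_measurable borel" "g \<in> borel_measurable borel"
    using borel_measurable_integrable[OF f] borel_measurable_integrable[OF g] by simp_all
  have i: "integrable (lborel \<Otimes>\<^sub>M lborel) (\<lambda>(x, y). f x * g y)"
  proof (rule lborel_pair.Fubini_integrable)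
    show "integrable lborel (\<lambda>x. \<integral>y. norm (case (x, y) of (x, y) \<Rightarrow> f x * g y) \<partial>lborel)"
      using f by (simp add: abs_mult)
    show "AE x in lborel. integrable lborel (\<lambda>y. case (x, y) of (x, y) \<Rightarrow> f x * g y)"
      using g by simp
  qed measurable
  then show "integrable lborel (\<lambda>(x, y). f x * g y)" by (simp only: lborel_prod)
  show "(\<integral>(x, y). f x * g y \<partial>lborel) = (\<integral>x. f x \<partial>lborel) * (\<integral>y. g y \<partial>lborel)"
    using lborel_pair.integral_fst'[OF i] by (simp add: lborel_prod)
qed

locale double_reflection =
  fixes i j :: "'n::finite" and l s :: real
  assumes ij: "i \<noteq> j" and s: "0 < s"
begin

definition Q :: "(real ^ 'n) set" where
  "Q = {x. l < x $ i \<and> 0 < x $ j}"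

text \<open>The folded kernel: each image of x carries the sign that a function odd in both mirrors
  picks up there, so integrating such a function against the kernel over the whole space amounts to
  integrating it against \<open>K\<close> over \<open>Q\<close>.\<close>

definition K :: "real ^ 'n \<Rightarrow> real ^ 'n \<Rightarrow> real" where
  "K x y = kern s (x - y) - kern s (reflect i l x - y) - kern s (reflect j 0 x - y)
     + kern s (reflect i l (reflect j 0 x) - y)"

definition odd2 :: "(real ^ 'n \<Rightarrow> real) \<Rightarrow> bool" where
  "odd2 W \<longleftrightarrow> (\<forall>x. W (reflect i l x) = - W x \<and> W (reflect j 0 x) = - W x)"

text \<open>The shift by \<open>\<epsilon>\<close> gives compact support inside \<open>\<Omega>\<close> to the test functions; the nonlinearity
  may be unbounded near the boundary.\<close>

definition neg :: "real \<Rightarrow> (real ^ 'n \<Rightarrow> real) \<Rightarrow> real ^ 'n \<Rightarrow> real" where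
  "neg \<epsilon> W x = (if x \<in> Q then max 0 (- W x - \<epsilon>) else 0)"

lemma odd2D: "odd2 W \<Longrightarrow> W (reflect i l x) = - W x" "odd2 W \<Longrightarrow> W (reflect j 0 x) = - W x"
  by (auto simp: odd2_def)

lemma odd2_zero:
  assumes "odd2 W" "x $ i = l \<or> x $ j = 0"
  shows "W x = 0"
proof -
  have "reflect i l x = x \<or> reflect j 0 x = x"
    using assms(2) by (auto simp: vec_eq_iff reflect_nth)
  then show ?thesis using odd2D[OF assms(1), of x] by auto
qed

lemma reflect_notin_Q:
  assumes "l \<le> x $ i" "0 \<le> x $ j"
  shows "reflect i l x \<notin> Q" "reflect j 0 x \<notin> Q" "reflect i l (reflect j 0 x) \<notin> Q"
  using assms ij by (auto simp: Q_def reflect_nth)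

lemma open_Q: "open Q"
proof -
  have "Q = {x. l < x $ i} \<inter> {x. 0 < x $ j}" by (auto simp: Q_def)
  then show ?thesis
    by (auto intro!: open_Int open_Collect_less continuous_intros)
qed

lemma Q_borel [measurable]: "Q \<in> sets borel"
  using open_Q by simp

lemma neg_nonneg [simp]: "0 \<le> neg \<epsilon> W x"
  by (simp add: neg_def)

lemma neg_measurable [measurable]:
  assumes [measurable]: "W \<in> borel_measurable borel"
  shows "neg \<epsilon> W \<in> borel_measurable borel"
  unfolding neg_def[abs_def] by measurable

lemma norm_quad:
  defines "A x y \<equiv> 4 * ((x $ i - l) * (y $ i - l))" and "B x y \<equiv> 4 * (x $ j * y $ j)"
  shows "(norm (reflect i l x - y))\<^sup>2 = (norm (x - y))\<^sup>2 + A x y"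
    and "(norm (reflect j 0 x - y))\<^sup>2 = (norm (x - y))\<^sup>2 + B x y"
    and "(norm (reflect i l (reflect j 0 x) - y))\<^sup>2 = (norm (x - y))\<^sup>2 + A x y + B x y"
  using norm_diff_reflect_sq[of x i l y] norm_diff_reflect_sq[of x j 0 y]
    norm_diff_reflect_sq[of x j 0 "reflect i l y"] ij
  by (simp_all add: norm_reflect_diff A_def B_def reflect_nth)

lemma K_pos:
  assumes "x \<in> Q" "y \<in> Q" "x \<noteq> y"
  shows "0 < K x y"
  unfolding K_def using assms
  by (intro kern_quad_pos[OF s _ _ _ norm_quad]) (auto simp: Q_def)

lemma K_nonneg:
  assumes "l \<le> x $ i" "0 \<le> x $ j" "y \<in> Q" "x \<noteq> y"
  shows "0 \<le> K x y"
  unfolding K_def using assms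
  by (intro kern_quad_nonneg[OF s _ _ _ norm_quad]) (auto simp: Q_def)

section \<open>Finite energy of the cut-off negative part\<close>

lemma frac_integrand_odd2_swap:
  assumes "odd2 W"
  shows "frac_integrand s W W (reflect i l x, y) = frac_integrand s W W (reflect i l y, x)"
    and "frac_integrand s W W (reflect j 0 x, y) = frac_integrand s W W (reflect j 0 y, x)"
  using norm_reflect_diff[of i l x y] norm_reflect_diff[of j 0 x y]
  by (auto simp: frac_integrand_eq kern_def odd2D[OF assms] norm_minus_commute algebra_simps)

text \<open>Integrable for \<open>W\<close> of finite energy, because reflecting a single variable
  preserves the product measure. The two reflected copies take care of pairs of points of which only
  one lies in \<open>Q\<close>.\<close>

definition energy_bound :: "(real ^ 'n \<Rightarrow> real) \<Rightarrow> (real ^ 'n) \<times> (real ^ 'n) \<Rightarrow> real" where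
  "energy_bound W = (\<lambda>(x, y). frac_integrand s W W (x, y) + frac_integrand s W W (reflect i l x, y)
     + frac_integrand s W W (reflect j 0 x, y))"

lemma frac_integrand_self_nonneg: "0 \<le> frac_integrand s W W p"
  by (cases p) (simp add: frac_integrand_eq)

text \<open>If \<open>W x\<close> has the wrong sign, one of the reflected points is closer to \<open>y\<close> and has the right one.\<close>

lemma neg_energy_bound_outside:
  assumes W: "odd2 W" and e: "0 \<le> \<epsilon>" and y: "y \<in> Q" and x: "x \<notin> Q"
  shows "(neg \<epsilon> W y)\<^sup>2 * kern s (x - y) \<le> energy_bound W (x, y)"
proof (cases "neg \<epsilon> W y = 0")
  case True
  then show ?thesis by (simp add: energy_bound_def frac_integrand_self_nonneg)
next
  case False
  then have v: "neg \<epsilon> W y = - W y - \<epsilon>" and Wy: "W y < 0"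
    using y e by (auto simp: neg_def max_def split: if_splits)
  have *: "(neg \<epsilon> W y)\<^sup>2 * kern s (x - y) \<le> frac_integrand s W W (z, y)"
    if z: "0 \<le> W z" "norm (z - y) \<le> norm (x - y)" for z
  proof -
    have "z \<noteq> y" using z Wy by auto
    then have "kern s (x - y) \<le> kern s (z - y)" using z s by (intro kern_antimono) auto
    moreover have "(neg \<epsilon> W y)\<^sup>2 \<le> (W z - W y)\<^sup>2"
      using v Wy z e neg_nonneg[of \<epsilon> W y] by (intro power_mono) auto
    ultimately show ?thesis
      by (auto simp: frac_integrand_eq power2_eq_square intro!: mult_mono)
  qed
  show ?thesis
  proof (cases "0 \<le> W x")
    case True
    then show ?thesis using *[of x] by (simp add: energy_bound_def frac_integrand_self_nonneg add.assoc add_increasing2)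
  next
    case neg: False
    consider "x $ i \<le> l" | "x $ j \<le> 0" using x by (auto simp: Q_def not_less)
    then show ?thesis
    proof cases
      case 1
      then have "(x $ i - l) * (y $ i - l) \<le> 0"
        using y by (intro mult_nonpos_nonneg) (auto simp: Q_def)
      then have "norm (reflect i l x - y) \<le> norm (x - y)"
        using norm_quad(1)[of x y] by (auto intro: power2_le_imp_le[OF _ norm_ge_zero])
      with *[of "reflect i l x"] neg show ?thesis
        by (simp add: energy_bound_def frac_integrand_self_nonneg odd2D[OF W] add_increasing add_increasing2)
    next
      case 2
      then have "x $ j * y $ j \<le> 0"
        using y by (intro mult_nonpos_nonneg) (auto simp: Q_def)
      then have "norm (reflect j 0 x - y) \<le> norm (x - y)"
        using norm_quad(2)[of x y] by (auto intro: power2_le_imp_le[OF _ norm_ge_zero])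
      with *[of "reflect j 0 x"] neg show ?thesis
        by (simp add: energy_bound_def frac_integrand_self_nonneg odd2D[OF W] add_increasing add_increasing2)
    qed
  qed
qed

lemma neg_energy_bound:
  assumes W: "odd2 W" and e: "0 \<le> \<epsilon>"
  shows "frac_integrand s (neg \<epsilon> W) (neg \<epsilon> W) (x, y) \<le> energy_bound W (x, y)"
proof -
  \<comment> \<open>With one variable reflected, oddness turns the difference of values into a sum,
    which is symmetric in x and y like the distance itself.\<close>
  have sym: "energy_bound W (x, y) = energy_bound W (y, x)"
    using frac_integrand_odd2_swap[OF W, of x y]
    by (simp add: energy_bound_def) (simp add: frac_integrand_eq kern_minus_commute algebra_simps)
  consider "x \<in> Q" "y \<in> Q" | "x \<notin> Q" "y \<in> Q" | "x \<in> Q" "y \<notin> Q" | "x \<notin> Q" "y \<notin> Q" by blast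
  then show ?thesis
  proof cases
    case 1
    have "\<bar>neg \<epsilon> W x - neg \<epsilon> W y\<bar> \<le> \<bar>W x - W y\<bar>" using 1 by (auto simp: neg_def)
    then have "(neg \<epsilon> W x - neg \<epsilon> W y)\<^sup>2 \<le> (W x - W y)\<^sup>2" by (simp add: abs_le_square_iff)
    then have "frac_integrand s (neg \<epsilon> W) (neg \<epsilon> W) (x, y) \<le> frac_integrand s W W (x, y)"
      by (simp add: frac_integrand_eq mult_right_mono flip: power2_eq_square)
    then show ?thesis by (simp add: energy_bound_def frac_integrand_self_nonneg add.assoc add_increasing2)
  next
    case 2
    then show ?thesis using neg_energy_bound_outside[OF W e, of y x]
      by (simp add: frac_integrand_eq neg_def power2_eq_square)
  next
    case 3
    then show ?thesis using neg_energy_bound_outside[OF W e, of x y]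
      by (simp add: frac_integrand_eq neg_def power2_eq_square sym kern_minus_commute[of s x])
  qed (simp add: frac_integrand_eq neg_def energy_bound_def frac_integrand_self_nonneg)
qed

text \<open>Restricting a function of finite energy to \<open>Q\<close> may in general make the
  energy infinite. Domination by \<open>energy_bound\<close> excludes this for odd
  functions.\<close>

lemma neg_energy_space:
  assumes W: "odd2 W" "W \<in> energy_space s" and e: "0 \<le> \<epsilon>"
  shows "neg \<epsilon> W \<in> energy_space s"
proof -
  have [measurable]: "W \<in> borel_measurable borel" using W by auto
  have "integrable lborel (energy_bound W)"
    using energy_spaceD(3)[OF W(2)]
      integral_reflect_left(2)[OF frac_integrand_measurable, of W W s i l]
      integral_reflect_left(2)[OF frac_integrand_measurable, of W W s j 0]
    by (simp add: energy_bound_def case_prod_unfold)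
  then have "integrable lborel (frac_integrand s (neg \<epsilon> W) (neg \<epsilon> W))"
    by (rule Bochner_Integration.integrable_bound)
      (auto simp: frac_integrand_self_nonneg intro!: order_trans[OF neg_energy_bound[OF W(1) e]])
  moreover have "integrable lborel (\<lambda>x. (neg \<epsilon> W x)\<^sup>2)"
  proof (rule Bochner_Integration.integrable_bound)
    show "integrable lborel (\<lambda>x. (W x)\<^sup>2)" using W(2) by auto
    have "(neg \<epsilon> W x)\<^sup>2 \<le> (W x)\<^sup>2" for x
      using e by (auto simp: neg_def max_def abs_le_square_iff[symmetric])
    then show "AE x in lborel. norm ((neg \<epsilon> W x)\<^sup>2) \<le> norm ((W x)\<^sup>2)" by simp
  qed measurable
  ultimately show ?thesis by (simp add: energy_space_def)
qed

section \<open>Testing with the negative part\<close>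

context
  fixes W :: "real ^ 'n \<Rightarrow> real" and \<epsilon> :: real
  assumes W: "odd2 W" and e: "0 \<le> \<epsilon>"
begin

text \<open>On \<open>Q\<close> the first factor is the positive part of
  \<open>W + \<epsilon>\<close>; off \<open>Q\<close>, where \<open>neg\<close> is 0, it is all of
  \<open>W + \<epsilon>\<close> and may be negative, so that \<open>cross\<close> by itself has no
  sign.\<close>

definition cross :: "real ^ 'n \<Rightarrow> real ^ 'n \<Rightarrow> real" where
  "cross x y = (W x + neg \<epsilon> W x + \<epsilon>) * neg \<epsilon> W y * kern s (x - y)"

text \<open>All four images of x contribute the same double integral, so a sign is needed only for
  their sum.\<close>

definition cross_sum :: "real ^ 'n \<Rightarrow> real ^ 'n \<Rightarrow> real" where
  "cross_sum x y = cross x y + cross (reflect i l x) y + cross (reflect j 0 x) y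
     + cross (reflect i l (reflect j 0 x)) y"

lemma cross_disjoint: "(W x + neg \<epsilon> W x + \<epsilon>) * neg \<epsilon> W x = 0"
  by (auto simp: neg_def max_def)

text \<open>Write W = z - v - \<epsilon> with v the negative part. The constant drops out of
  differences and z v = 0 at every point, so besides the energy density of v only the two mixed
  products of z and v survive.\<close>

lemma frac_integrand_neg:
  "frac_integrand s W (neg \<epsilon> W) (x, y)
    = - frac_integrand s (neg \<epsilon> W) (neg \<epsilon> W) (x, y) - cross x y - cross y x"
proof -
  define v where "v = neg \<epsilon> W"
  define z where "z x = W x + v x + \<epsilon>" for x
  have z: "z x * v x = 0" "z y * v y = 0" using cross_disjoint by (auto simp: z_def v_def)
  have "(W x - W y) * (v x - v y) = - ((v x - v y) * (v x - v y)) + (z x - z y) * (v x - v y)"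
    by (simp add: z_def algebra_simps)
  also have "(z x - z y) * (v x - v y) = z x * v x + z y * v y - z x * v y - z y * v x"
    by (simp add: algebra_simps)
  finally have eq: "(W x - W y) * (v x - v y) = - ((v x - v y) * (v x - v y)) - z x * v y - z y * v x"
    using z by simp
  show ?thesis
    unfolding frac_integrand_eq cross_def v_def[symmetric] z_def[symmetric] eq kern_minus_commute[of s y]
    by (simp add: algebra_simps)
qed

text \<open>For W x \<ge> 0 the terms in W x add up to W x times \<open>K x y\<close>, nonnegative
  by convexity, and the terms in \<epsilon> are all nonnegative. For W x < 0 monotonicity of the
  kernel is enough: only the image under both reflections can contribute negatively, and the image
  under the first reflection, which is at least as close to y, compensates for it.\<close>

lemma cross_sum_core:
  assumes x: "l \<le> x $ i" "0 \<le> x $ j" and y: "neg \<epsilon> W y \<noteq> 0"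
  shows "max 0 (W x) * K x y * neg \<epsilon> W y \<le> cross_sum x y" "0 \<le> cross_sum x y"
proof -
  have yQ: "y \<in> Q" and Wy: "W y < 0" using y e by (auto simp: neg_def max_def split: if_splits)
  define k0 k1 k2 k3 where "k0 = kern s (x - y)" and "k1 = kern s (reflect i l x - y)"
    and "k2 = kern s (reflect j 0 x - y)" and "k3 = kern s (reflect i l (reflect j 0 x) - y)"
  have k: "0 \<le> k0" "0 \<le> k1" "0 \<le> k2" "0 \<le> k3" by (simp_all add: k0_def k1_def k2_def k3_def)
  have k31: "k3 \<le> k1"
  proof -
    have "reflect i l x - y \<noteq> 0" using reflect_notin_Q[OF x] yQ by auto
    moreover have "0 \<le> x $ j * y $ j" using x yQ by (simp add: Q_def)
    then have "norm (reflect i l x - y) \<le> norm (reflect i l (reflect j 0 x) - y)"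
      using norm_quad(1,3)[of x y] by (auto intro: power2_le_imp_le[OF _ norm_ge_zero])
    ultimately show ?thesis unfolding k1_def k3_def using s by (intro kern_antimono)
  qed
  \<comment> \<open>A point x on a mirror is not in \<open>Q\<close>, but W vanishes there and the
    formula still gives 0.\<close>
  have nx: "neg \<epsilon> W x = max 0 (- W x - \<epsilon>)"
  proof (cases "x \<in> Q")
    case False
    then have "W x = 0" using x odd2_zero[OF W, of x] by (auto simp: Q_def)
    then show ?thesis using e False by (simp add: neg_def)
  qed (simp add: neg_def)
  have nr: "neg \<epsilon> W (reflect i l x) = 0" "neg \<epsilon> W (reflect j 0 x) = 0"
     "neg \<epsilon> W (reflect i l (reflect j 0 x)) = 0"
    using reflect_notin_Q[OF x] by (simp_all add: neg_def)
  have eq: "cross_sum x y = ((W x + max 0 (- W x - \<epsilon>) + \<epsilon>) * k0 + (\<epsilon> - W x) * k1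
      + (\<epsilon> - W x) * k2 + (\<epsilon> + W x) * k3) * neg \<epsilon> W y"
    by (simp add: cross_sum_def cross_def nx nr odd2D[OF W] k0_def k1_def k2_def k3_def algebra_simps)
  have K: "K x y = k0 - k1 - k2 + k3" by (simp add: K_def k0_def k1_def k2_def k3_def)
  have "max 0 (W x) * K x y * neg \<epsilon> W y \<le> cross_sum x y \<and> 0 \<le> cross_sum x y"
  proof (cases "0 \<le> W x")
    case True
    then have "x \<noteq> y" using Wy by auto
    then have "0 \<le> K x y" using K_nonneg x yQ by blast
    have "W x * K x y + \<epsilon> * (k0 + k1 + k2 + k3) = (W x + max 0 (- W x - \<epsilon>) + \<epsilon>) * k0 + (\<epsilon> - W x) * k1
      + (\<epsilon> - W x) * k2 + (\<epsilon> + W x) * k3"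
      using True e by (simp add: K algebra_simps)
    then have c: "cross_sum x y = (W x * K x y + \<epsilon> * (k0 + k1 + k2 + k3)) * neg \<epsilon> W y"
      by (simp add: eq)
    have "0 \<le> \<epsilon> * (k0 + k1 + k2 + k3)" using e k by simp
    then have "W x * K x y * neg \<epsilon> W y \<le> cross_sum x y"
      unfolding c by (intro mult_right_mono) auto
    moreover have "0 \<le> W x * K x y * neg \<epsilon> W y" using True \<open>0 \<le> K x y\<close> by simp
    ultimately show ?thesis using True by simp
  next
    case False
    have "0 \<le> (W x + max 0 (- W x - \<epsilon>) + \<epsilon>) * k0" using k by simp
    moreover have "0 \<le> (\<epsilon> - W x) * k2" using k e False by simp
    moreover have "0 \<le> - W x * (k1 - k3) + \<epsilon> * (k1 + k3)"
      using k31 k e False by (intro add_nonneg_nonneg mult_nonneg_nonneg) auto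
    ultimately have "0 \<le> (W x + max 0 (- W x - \<epsilon>) + \<epsilon>) * k0 + (\<epsilon> - W x) * k1
      + (\<epsilon> - W x) * k2 + (\<epsilon> + W x) * k3" by (simp add: algebra_simps)
    then have "0 \<le> cross_sum x y" unfolding eq by simp
    then show ?thesis using False by simp
  qed
  then show "max 0 (W x) * K x y * neg \<epsilon> W y \<le> cross_sum x y" "0 \<le> cross_sum x y" by auto
qed

lemma cross_sum_reflect:
  "cross_sum (reflect i l x) y = cross_sum x y" "cross_sum (reflect j 0 x) y = cross_sum x y"
  using ij by (simp_all add: cross_sum_def reflect_commute[of i j])

text \<open>Reflecting x merely permutes the four summands, so x can be moved into the closed
  quarter space.\<close>

lemma cross_sum_nonneg: "0 \<le> cross_sum x y"
proof (cases "neg \<epsilon> W y = 0")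
  case True
  then show ?thesis by (simp add: cross_sum_def cross_def)
next
  case False
  define x1 where "x1 = (if x $ i < l then reflect i l x else x)"
  define x2 where "x2 = (if x1 $ j < 0 then reflect j 0 x1 else x1)"
  have "l \<le> x2 $ i" "0 \<le> x2 $ j" using ij by (auto simp: x1_def x2_def reflect_nth)
  then have "0 \<le> cross_sum x2 y" using cross_sum_core False by blast
  then show ?thesis by (simp add: x1_def x2_def cross_sum_reflect split: if_splits)
qed

text \<open>The mixed products enter twice, and folding spreads them over four images; hence the
  factor 1/2. The last term is the gain from a set \<open>B\<close> on which W is positive. An empty
  \<open>B\<close> leaves the plain energy inequality.\<close>

lemma frac_bilin_neg_le:
  assumes WE: "W \<in> energy_space s" and v: "integrable lborel (neg \<epsilon> W)"
    and B: "B \<in> sets borel" "emeasure lborel B < \<infinity>" "B \<subseteq> Q"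
    and k0: "0 \<le> k0" "\<And>x y. x \<in> B \<Longrightarrow> neg \<epsilon> W y \<noteq> 0 \<Longrightarrow> k0 \<le> max 0 (W x) * K x y"
  shows "frac_bilin s W (neg \<epsilon> W)
    \<le> - frac_bilin s (neg \<epsilon> W) (neg \<epsilon> W) - k0 * measure lborel B / 2 * (\<integral>x. neg \<epsilon> W x \<partial>lborel)"
proof -
  note [measurable] = B(1)
  have [measurable]: "W \<in> borel_measurable borel" using WE by auto
  define h where "h = (\<lambda>(x, y). cross x y)"
  have h [measurable]: "h \<in> borel_measurable borel"
    unfolding h_def cross_def borel_prod[symmetric] by measurable
  have nE: "neg \<epsilon> W \<in> energy_space s" using neg_energy_space[OF W WE e] .
  have int: "integrable lborel (frac_integrand s W (neg \<epsilon> W))"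
    "integrable lborel (frac_integrand s (neg \<epsilon> W) (neg \<epsilon> W))"
    using integrable_frac_integrand nE WE by blast+
  have eq: "h (x, y) + h (y, x) = - frac_integrand s (neg \<epsilon> W) (neg \<epsilon> W) (x, y) - frac_integrand s W (neg \<epsilon> W) (x, y)" for x y
    using frac_integrand_neg[of x y] by (simp add: h_def)
  \<comment> \<open>Since z v = 0, one of \<open>h (x, y)\<close> and \<open>h (y, x)\<close> is 0,
    so each is bounded by their sum, which is already known to be integrable.\<close>
  have hint: "integrable lborel h"
  proof (rule Bochner_Integration.integrable_bound)
    show "integrable lborel (\<lambda>p. - frac_integrand s (neg \<epsilon> W) (neg \<epsilon> W) p - frac_integrand s W (neg \<epsilon> W) p)"
      using int by simp
    have "norm (h (x, y)) \<le> norm (h (x, y) + h (y, x))" for x y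
      using cross_disjoint[of x] cross_disjoint[of y] by (auto simp: h_def cross_def)
    then show "AE p in lborel. norm (h p) \<le> norm (- frac_integrand s (neg \<epsilon> W) (neg \<epsilon> W) p - frac_integrand s W (neg \<epsilon> W) p)"
      using eq by auto
  qed measurable
  have hs: "integrable lborel (\<lambda>(x, y). h (y, x))" "(\<integral>(x, y). h (y, x) \<partial>lborel) = (\<integral>p. h p \<partial>lborel)"
    using integral_swap[OF h] hint by simp_all
  have "frac_bilin s W (neg \<epsilon> W) = (\<integral>p. - frac_integrand s (neg \<epsilon> W) (neg \<epsilon> W) p - h p - (case p of (x, y) \<Rightarrow> h (y, x)) \<partial>lborel)"
    unfolding frac_bilin_def
    by (intro Bochner_Integration.integral_cong refl) (use frac_integrand_neg in \<open>auto simp: h_def\<close>)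
  also have "\<dots> = - frac_bilin s (neg \<epsilon> W) (neg \<epsilon> W) - 2 * (\<integral>p. h p \<partial>lborel)"
    using int hint hs by (simp add: frac_bilin_def)
  finally have 1: "frac_bilin s W (neg \<epsilon> W) = - frac_bilin s (neg \<epsilon> W) (neg \<epsilon> W) - 2 * (\<integral>p. h p \<partial>lborel)" .
  define ha where "ha = (\<lambda>(x, y). h (reflect i l x, y))"
  have ha [measurable]: "ha \<in> borel_measurable borel"
    using measurable_compose[OF measurable_reflect_left h, of i l] by (simp add: ha_def case_prod_unfold)
  note ra = integral_reflect_left[OF h, of i l, folded ha_def]
  note rb = integral_reflect_left[OF h, of j 0]
  note rab = integral_reflect_left[OF ha, of j 0]
  have "(\<integral>(x, y). cross_sum x y \<partial>lborel) = (\<integral>p. h p + ha p + (case p of (x, y) \<Rightarrow> h (reflect j 0 x, y))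
      + (case p of (x, y) \<Rightarrow> ha (reflect j 0 x, y)) \<partial>lborel)"
    by (intro Bochner_Integration.integral_cong refl) (auto simp: cross_sum_def h_def ha_def)
  also have "\<dots> = 4 * (\<integral>p. h p \<partial>lborel)"
    using hint ra rb rab by simp
  finally have 2: "(\<integral>(x, y). cross_sum x y \<partial>lborel) = 4 * (\<integral>p. h p \<partial>lborel)" .
  have csi: "integrable lborel (\<lambda>(x, y). cross_sum x y)"
  proof -
    have "(\<lambda>(x, y). cross_sum x y) = (\<lambda>p. h p + ha p + (case p of (x, y) \<Rightarrow> h (reflect j 0 x, y))
      + (case p of (x, y) \<Rightarrow> ha (reflect j 0 x, y)))"
      by (auto simp: cross_sum_def h_def ha_def)
    then show ?thesis using hint ra rb rab by simp
  qed
  have Bi: "integrable lborel (\<lambda>x. k0 * indicator B x :: real)" using B by simp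
  have "k0 * measure lborel B * (\<integral>x. neg \<epsilon> W x \<partial>lborel) = (\<integral>(x, y). (k0 * indicator B x) * neg \<epsilon> W y \<partial>lborel)"
    using integral_tensor(2)[OF Bi v] by simp
  also have "\<dots> \<le> (\<integral>(x, y). cross_sum x y \<partial>lborel)"
  proof (rule integral_mono[OF integral_tensor(1)[OF Bi v] csi])
    fix p :: "(real ^ 'n) \<times> (real ^ 'n)"
    obtain x y where p: "p = (x, y)" by (cases p)
    have "k0 * indicator B x * neg \<epsilon> W y \<le> cross_sum x y"
    proof (cases "x \<in> B \<and> neg \<epsilon> W y \<noteq> 0")
      case True
      then have "k0 * neg \<epsilon> W y \<le> max 0 (W x) * K x y * neg \<epsilon> W y"
        using k0(2) by (intro mult_right_mono) auto
      also have "\<dots> \<le> cross_sum x y"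
        using True B(3) by (intro cross_sum_core) (auto simp: Q_def)
      finally show ?thesis using True by simp
    next
      case False
      then have "k0 * indicator B x * neg \<epsilon> W y = 0" by auto
      then show ?thesis using cross_sum_nonneg[of x y] by linarith
    qed
    then show "(case p of (x, y) \<Rightarrow> (k0 * indicator B x) * neg \<epsilon> W y) \<le> (case p of (x, y) \<Rightarrow> cross_sum x y)"
      by (simp add: p)
  qed
  finally show ?thesis using 1 2 by simp
qed

end

end

section \<open>Estimates for the bilinear form\<close>

lemma distr_lborel_diff:
  "distr lborel borel (\<lambda>y. x - y) = (lborel :: 'a::euclidean_space measure)"
  using lborel_affine[of "-1" x] by (simp add: density_1)

lemma integral_lborel_translate:
  fixes g :: "'a::euclidean_space \<Rightarrow> real"
  assumes [measurable]: "g \<in> borel_measurable borel"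
  shows "(\<integral>y. g (x - y) \<partial>lborel) = (\<integral>y. g y \<partial>lborel)"
    and "integrable lborel (\<lambda>y. g (x - y)) \<longleftrightarrow> integrable lborel g"
    and "(\<integral>y. g (x + y) \<partial>lborel) = (\<integral>y. g y \<partial>lborel)"
    and "integrable lborel (\<lambda>y. g (x + y)) \<longleftrightarrow> integrable lborel g"
  using integral_lborel_distr[OF distr_lborel_diff _ assms, of x]
    integral_lborel_distr[OF lborel_distr_plus _ assms, of x] by simp_all

lemma integral_convolution:
  fixes f g :: "'a::euclidean_space \<Rightarrow> real"
  assumes f: "integrable lborel f" and g: "integrable lborel g"
  shows "integrable lborel (\<lambda>(x, y). f x * g (x - y))"
proof -
  have [measurable]: "f \<in> borel_measurable borel" "g \<in> borel_measurable borel"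
    using borel_measurable_integrable[OF f] borel_measurable_integrable[OF g] by simp_all
  have "integrable (lborel \<Otimes>\<^sub>M lborel) (\<lambda>(x, y). f x * g (x - y))"
  proof (rule lborel_pair.Fubini_integrable)
    show "integrable lborel (\<lambda>x. \<integral>y. norm (case (x, y) of (x, y) \<Rightarrow> f x * g (x - y)) \<partial>lborel)"
      using f integral_lborel_translate(1)[of "\<lambda>y. \<bar>g y\<bar>"] by (simp add: abs_mult)
    show "AE x in lborel. integrable lborel (\<lambda>y. case (x, y) of (x, y) \<Rightarrow> f x * g (x - y))"
      using g by (simp add: integral_lborel_translate(2))
  qed measurable
  then show "integrable lborel (\<lambda>(x, y). f x * g (x - y))" by (simp only: lborel_prod)
qed

text \<open>A set of small measure leaves most of a ball around each of its points uncovered.\<close>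

lemma frac_bilin_ge_small_support:
  fixes s M :: real
  assumes s: "0 < s" and M: "0 < M"
  obtains \<delta> where "0 < \<delta>"
    "\<And>v :: real ^ 'n \<Rightarrow> real. v \<in> energy_space s \<Longrightarrow> emeasure lborel {x. v x \<noteq> 0} \<le> ennreal \<delta> \<Longrightarrow>
      M * (\<integral>x. (v x)\<^sup>2 \<partial>lborel) \<le> frac_bilin s v v"
proof
  define N where "N = CARD('n)"
  define \<omega> where "\<omega> = unit_ball_vol (real N)"
  have \<omega>: "0 < \<omega>" by (simp add: \<omega>_def)
  \<comment> \<open>Inside a ball of radius R the kernel is at least c = R^(-N-2s), and a support of
    measure at most \<delta>, half the volume of the ball, leaves half of the ball free. R is chosen
    so that c \<delta> = M.\<close>
  define R where "R = (\<omega> / (2 * M)) powr (1 / (2 * s))"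
  have R: "0 < R" using \<omega> M by (simp add: R_def)
  define c where "c = 1 / R powr (real N + 2 * s)"
  have c0: "0 < c" using R by (simp add: c_def)
  have R2: "R powr (2 * s) = \<omega> / (2 * M)"
    using \<omega> M s by (simp add: R_def powr_powr)
  have RN: "R powr (real N + 2 * s) = R ^ N * R powr (2 * s)"
    using R by (simp add: powr_add powr_realpow)
  have cR: "c * (\<omega> * R ^ N / 2) = M"
    using R \<omega> M by (simp add: c_def RN R2)
  define \<delta> where "\<delta> = \<omega> * R ^ N / 2"
  show "0 < \<delta>" using \<omega> R by (simp add: \<delta>_def)
  fix v :: "real ^ 'n \<Rightarrow> real"
  assume v: "v \<in> energy_space s" and small: "emeasure lborel {x. v x \<noteq> 0} \<le> ennreal \<delta>"
  have [measurable]: "v \<in> borel_measurable borel" using v by auto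
  define A where "A = {x. v x \<noteq> 0}"
  have [measurable]: "A \<in> sets borel" unfolding A_def by measurable
  have fin: "emeasure lborel (ball x R) < \<infinity>" for x :: "real ^ 'n"
    using emeasure_bounded_finite[OF bounded_ball] by (simp add: top.not_eq_extremum)
  have m: "M \<le> c * measure lborel (ball x R - A)" for x
  proof -
    have "measure lborel (ball x R) = 2 * \<delta>"
      using content_ball[of R x] R by (simp add: \<delta>_def \<omega>_def N_def)
    moreover have "measure lborel A \<le> \<delta>"
      using small \<open>0 < \<delta>\<close> unfolding A_def[symmetric] measure_def by (intro enn2real_leI) auto
    moreover have "measure lborel (ball x R) \<le> measure lborel (ball x R - A) + measure lborel A"
    proof -
      have A: "A \<in> fmeasurable lborel"
        using order_le_less_trans[OF small] by (auto simp: A_def intro!: fmeasurableI)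
      have "ball x R \<in> fmeasurable lborel" using fin[of x] by (auto intro: fmeasurableI)
      with A have "(ball x R - A) \<union> A \<in> fmeasurable lborel" by (intro fmeasurable.Un fmeasurable.Diff)
      then have "measure lborel (ball x R) \<le> measure lborel ((ball x R - A) \<union> A)"
        by (rule measure_mono_fmeasurable[rotated 2]) auto
      also have "\<dots> \<le> measure lborel (ball x R - A) + measure lborel A"
        by (intro measure_Un_le) auto
      finally show ?thesis .
    qed
    ultimately have "\<delta> \<le> measure lborel (ball x R - A)" by linarith
    then show ?thesis using c0 cR mult_left_mono[of \<delta> _ c] by (simp add: \<delta>_def)
  qed
  define F where "F = frac_integrand s v v"
  have F: "integrable (lborel \<Otimes>\<^sub>M lborel) F" using v by (auto simp: F_def lborel_prod)
  have "(\<integral>x. M * (v x)\<^sup>2 \<partial>lborel) \<le> (\<integral>x. (\<integral>y. F (x, y) \<partial>lborel) \<partial>lborel)"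
  proof (rule integral_mono_AE)
    show "integrable lborel (\<lambda>x. M * (v x)\<^sup>2)" using energy_spaceD(2)[OF v] by simp
    show "integrable lborel (\<lambda>x. \<integral>y. F (x, y) \<partial>lborel)" by (rule lborel_pair.integrable_fst'[OF F])
    show "AE x in lborel. M * (v x)\<^sup>2 \<le> (\<integral>y. F (x, y) \<partial>lborel)"
      using lborel_pair.AE_integrable_fst'[OF F]
    proof eventually_elim
      fix x assume i: "integrable lborel (\<lambda>y. F (x, y))"
      have i2: "integrable lborel (\<lambda>y. ((v x)\<^sup>2 * c) * indicator (ball x R - A) y)"
      proof (intro integrable_mult_right integrable_real_indicator)
        have "emeasure lborel (ball x R - A) \<le> emeasure lborel (ball x R)" by (intro emeasure_mono) auto
        then show "emeasure lborel (ball x R - A) < \<infinity>" using fin[of x] by (rule order_le_less_trans)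
      qed auto
      have "M * (v x)\<^sup>2 \<le> (v x)\<^sup>2 * (c * measure lborel (ball x R - A))"
        using mult_right_mono[OF m[of x] zero_le_power2[of "v x"]] by (simp add: mult.commute)
      also have "\<dots> = (\<integral>y. ((v x)\<^sup>2 * c) * indicator (ball x R - A) y \<partial>lborel)"
        by simp
      also have "\<dots> \<le> (\<integral>y. F (x, y) \<partial>lborel)"
      proof (rule integral_mono[OF i2 i])
        fix y
        show "((v x)\<^sup>2 * c) * indicator (ball x R - A) y \<le> F (x, y)"
        proof (cases "y \<in> ball x R - A \<and> v x \<noteq> 0")
          case True
          then have y: "v y = 0" "x \<noteq> y" "norm (x - y) < R" by (auto simp: A_def dist_norm)
          have "c \<le> kern s (x - y)"
            unfolding c_def kern_def N_def using y s by (intro divide_left_mono powr_mono2 mult_pos_pos) auto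
          then show ?thesis using True y
            by (simp add: F_def frac_integrand_eq mult_left_mono flip: power2_eq_square)
        next
          case False
          then have "((v x)\<^sup>2 * c) * indicator (ball x R - A) y = 0" by auto
          moreover have "0 \<le> F (x, y)" by (simp add: F_def frac_integrand_eq)
          ultimately show ?thesis by linarith
        qed
      qed
      finally show "M * (v x)\<^sup>2 \<le> (\<integral>y. F (x, y) \<partial>lborel)" .
    qed
  qed
  also have "\<dots> = frac_bilin s v v"
    using lborel_pair.integral_fst'[OF F] by (simp add: frac_bilin_def F_def lborel_prod)
  finally show "M * (\<integral>x. (v x)\<^sup>2 \<partial>lborel) \<le> frac_bilin s v v" by simp
qed

section \<open>Integrability of the truncated Levy kernel\<close>

lemma integrable_dyadic:
  fixes f :: "real ^ 'n \<Rightarrow> real" and c r :: "nat \<Rightarrow> real"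
  assumes f [measurable]: "f \<in> borel_measurable borel" "\<And>h. 0 \<le> f h"
    and pos: "\<And>k. 0 \<le> c k" "\<And>k. 0 \<le> r k"
    and ex: "\<And>h. f h \<noteq> 0 \<Longrightarrow> \<exists>k. norm h < r k \<and> f h \<le> c k"
    and sm: "summable (\<lambda>k. c k * r k ^ CARD('n))"
  shows "integrable lborel f"
proof (rule integrableI_nonneg)
  define \<omega> where "\<omega> = unit_ball_vol (real CARD('n))"
  have \<omega>: "0 \<le> \<omega>" by (simp add: \<omega>_def)
  \<comment> \<open>At each point a single term of the series already dominates f, so the balls may
    overlap.\<close>
  have "(\<integral>\<^sup>+h. ennreal (f h) \<partial>lborel) \<le> (\<integral>\<^sup>+h. (\<Sum>k. ennreal (c k) * indicator (ball (0 :: real ^ 'n) (r k)) h) \<partial>lborel)"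
  proof (rule nn_integral_mono)
    fix h :: "real ^ 'n"
    show "ennreal (f h) \<le> (\<Sum>k. ennreal (c k) * indicator (ball 0 (r k)) h)"
    proof (cases "f h = 0")
      case False
      then obtain k where k: "norm h < r k" "f h \<le> c k" using ex by blast
      define F where "F k = ennreal (c k) * indicator (ball 0 (r k)) h" for k
      have "ennreal (f h) \<le> F k" using k by (simp add: F_def ennreal_leI)
      also have "F k \<le> suminf F" using sum_le_suminf[of F "{k}"] by simp
      finally show ?thesis by (simp add: F_def[abs_def])
    qed simp
  qed
  also have "\<dots> = (\<Sum>k. \<integral>\<^sup>+h. ennreal (c k) * indicator (ball (0 :: real ^ 'n) (r k)) h \<partial>lborel)"
    by (rule nn_integral_suminf) (auto intro!: borel_measurable_times_ennreal borel_measurable_indicator)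
  also have "\<dots> = (\<Sum>k. ennreal (\<omega> * (c k * r k ^ CARD('n))))"
  proof (intro arg_cong[where f = suminf] ext)
    fix k
    have "(\<integral>\<^sup>+h. ennreal (c k) * indicator (ball (0 :: real ^ 'n) (r k)) h \<partial>lborel)
      = ennreal (c k) * ennreal (\<omega> * r k ^ CARD('n))"
      using emeasure_ball[of "r k" "0 :: real ^ 'n"] pos(2)[of k]
      by (subst nn_integral_cmult_indicator) (simp_all add: \<omega>_def)
    also have "\<dots> = ennreal (c k * (\<omega> * r k ^ CARD('n)))"
      using pos \<omega> by (intro ennreal_mult[symmetric]) auto
    finally show "(\<integral>\<^sup>+h. ennreal (c k) * indicator (ball (0 :: real ^ 'n) (r k)) h \<partial>lborel)
      = ennreal (\<omega> * (c k * r k ^ CARD('n)))" by (simp only: mult.left_commute)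
  qed
  also have "\<dots> = ennreal (\<Sum>k. \<omega> * (c k * r k ^ CARD('n)))"
    using pos \<omega> sm by (intro suminf_ennreal2) auto
  also have "\<dots> < \<infinity>" by simp
  finally show "(\<integral>\<^sup>+h. ennreal (f h) \<partial>lborel) < \<infinity>" .
qed (use f in auto)

text \<open>The Levy density of the fractional Laplacian with the weight min(1, |h|^2), which bounds
  second differences of a function that is bounded and has bounded curvature.\<close>

definition levy :: "real \<Rightarrow> real ^ 'n \<Rightarrow> real" where
  "levy s h = min 1 ((norm h)\<^sup>2) * kern s h"

lemma levy_measurable [measurable]: "levy s \<in> borel_measurable borel"
  unfolding levy_def[abs_def] by measurable

lemma levy_nonneg [simp]: "0 \<le> levy s h"
  by (simp add: levy_def)

lemma kern_le:
  fixes h :: "real ^ 'n"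
  assumes "0 < s" "0 < r" "r \<le> norm h"
  shows "kern s h \<le> 1 / r powr (real CARD('n) + 2 * s)"
  unfolding kern_def using assms by (intro divide_left_mono powr_mono2 mult_pos_pos) auto

text \<open>Dyadic shells reduce both parts to geometric series, with ratio 2^(-2s) away from the
  origin, where s > 0 matters, and 2^(2s-2) near it, where s < 1 matters.\<close>

lemma levy_integrable:
  assumes s: "0 < s" "s < 1"
  shows "integrable lborel (levy s :: real ^ 'n \<Rightarrow> real)"
proof -
  define N where "N = CARD('n)"
  define p where "p = real N + 2 * s"
  define f where "f h = (if 1 \<le> norm h then levy s h else 0)" for h :: "real ^ 'n"
  define g where "g h = (if norm h < 1 then levy s h else 0)" for h :: "real ^ 'n"
  have [measurable]: "f \<in> borel_measurable borel" "g \<in> borel_measurable borel"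
    unfolding f_def[abs_def] g_def[abs_def] by measurable
  have "integrable lborel f"
  proof (rule integrable_dyadic)
    fix h assume "f h \<noteq> 0"
    then have h: "1 \<le> norm h" by (auto simp: f_def split: if_splits)
    \<comment> \<open>Minimality supplies the lower bound 2^(k-1) \<le> |h|; k = 0 is impossible
      because |h| \<ge> 1.\<close>
    define k where "k = (LEAST k. norm h < 2 ^ k)"
    have k: "norm h < 2 ^ k"
      unfolding k_def using real_arch_pow[of 2 "norm h"] by (rule LeastI_ex) simp
    have "k \<noteq> 0" using k h by (cases k) auto
    then have "\<not> norm h < 2 ^ (k - 1)"
      using not_less_Least[of "k - 1" "\<lambda>k. norm h < 2 ^ k"] by (simp add: k_def)
    moreover have "(2::real) ^ (k - 1) = 2 ^ k / 2" using \<open>k \<noteq> 0\<close> by (cases k) auto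
    ultimately have "kern s h \<le> 1 / (2 ^ k / 2) powr p"
      unfolding p_def N_def using s by (intro kern_le) auto
    moreover have "f h = kern s h" using h by (simp add: f_def levy_def)
    ultimately show "\<exists>k. norm h < 2 ^ k \<and> f h \<le> 1 / (2 ^ k / 2) powr p" using k by auto
  next
    have "1 / (2 ^ k / 2) powr p * (2 ^ k) ^ N = 2 powr p * (2 powr (- 2 * s)) ^ k" for k
    proof -
      have "1 / (2 ^ k / 2) powr p * (2 ^ k) ^ N = 2 powr p * ((2 ^ k) powr (- p) * (2 ^ k) powr real N)"
        by (simp add: powr_divide powr_minus_divide powr_realpow)
      also have "(2 ^ k) powr (- p) * (2 ^ k) powr real N = (2 ^ k) powr (- 2 * s)"
        by (simp add: p_def flip: powr_add)
      also have "\<dots> = (2 powr (- 2 * s)) ^ k"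
        by (simp add: powr_power powr_realpow[symmetric] powr_powr mult.commute)
      finally show ?thesis .
    qed
    moreover have "summable (\<lambda>k. 2 powr p * (2 powr (- 2 * s)) ^ k)"
    proof -
      have "2 powr (- 2 * s) < 2 powr 0" using s by (intro powr_less_mono) auto
      then show ?thesis by (intro summable_mult summable_geometric) simp
    qed
    ultimately show "summable (\<lambda>k. 1 / (2 ^ k / 2) powr p * (2 ^ k) ^ CARD('n))" by (simp add: N_def)
  qed (auto simp: f_def)
  moreover have "integrable lborel g"
  proof (rule integrable_dyadic)
    fix h assume "g h \<noteq> 0"
    then have h: "norm h < 1" "h \<noteq> 0" by (auto simp: g_def levy_def split: if_splits)
    define k where "k = (LEAST k. (1/2) ^ k \<le> norm h)"
    have k: "(1/2) ^ k \<le> norm h"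
    proof -
      obtain n where "(1/2) ^ n < norm h" using real_arch_pow_inv[of "norm h" "1/2"] h by auto
      then show ?thesis unfolding k_def using LeastI[of "\<lambda>k. (1/2) ^ k \<le> norm h" n] by simp
    qed
    have "k \<noteq> 0" using k h by (cases k) auto
    then have "\<not> (1/2) ^ (k - 1) \<le> norm h"
      using not_less_Least[of "k - 1" "\<lambda>k. (1/2) ^ k \<le> norm h"] by (simp add: k_def)
    moreover have "(1/2 :: real) ^ (k - 1) = 2 * (1/2) ^ k" using \<open>k \<noteq> 0\<close> by (cases k) auto
    ultimately have k2: "norm h < 2 * (1/2) ^ k" by simp
    have "kern s h \<le> 1 / ((1/2) ^ k) powr p"
      unfolding p_def N_def using s k by (intro kern_le) auto
    moreover have "min 1 ((norm h)\<^sup>2) \<le> (2 * (1/2) ^ k)\<^sup>2"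
      using k2 by (intro min.coboundedI2 power_mono) auto
    ultimately have "levy s h \<le> (2 * (1/2) ^ k)\<^sup>2 * (1 / ((1/2) ^ k) powr p)"
      unfolding levy_def by (intro mult_mono) auto
    then show "\<exists>k. norm h < 2 * (1/2) ^ k \<and> g h \<le> (2 * (1/2) ^ k)\<^sup>2 * (1 / ((1/2) ^ k) powr p)"
      using k2 h by (auto simp: g_def)
  next
    have "(2 * (1/2) ^ k)\<^sup>2 * (1 / ((1/2) ^ k) powr p) * (2 * (1/2) ^ k) ^ N
      = (4 * 2 ^ N) * ((1/2) powr (2 - 2 * s)) ^ k" for k
    proof -
      define q :: real where "q = (1/2) ^ k"
      have q: "0 < q" by (simp add: q_def)
      have "(2 * q)\<^sup>2 * (1 / q powr p) * (2 * q) ^ N = 4 * 2 ^ N * (q powr 2 * q powr (- p) * q powr real N)"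
        using q by (simp add: powr_minus_divide powr_realpow power_mult_distrib)
      also have "q powr 2 * q powr (- p) * q powr real N = q powr (2 - 2 * s)"
        by (simp add: p_def flip: powr_add)
      also have "\<dots> = ((1/2) powr (2 - 2 * s)) ^ k"
        unfolding q_def by (simp add: powr_power powr_realpow[symmetric] powr_powr mult.commute)
      finally show ?thesis unfolding q_def .
    qed
    moreover have "summable (\<lambda>k. (4 * 2 ^ N) * ((1/2 :: real) powr (2 - 2 * s)) ^ k)"
    proof -
      have "(1/2 :: real) powr (2 - 2 * s) < (1/2) powr 0" using s by (intro powr_less_mono') auto
      then show ?thesis by (intro summable_mult summable_geometric) simp
    qed
    ultimately show "summable (\<lambda>k. (2 * (1/2) ^ k)\<^sup>2 * (1 / ((1/2) ^ k) powr p) * (2 * (1/2) ^ k) ^ CARD('n))"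
      by (simp add: N_def)
  qed (auto simp: g_def)
  ultimately have "integrable lborel (\<lambda>h. f h + g h)" by simp
  moreover have "(\<lambda>h. f h + g h) = levy s" by (auto simp: f_def g_def)
  ultimately show ?thesis by simp
qed

text \<open>The squared difference is at most a constant times min(1, |x - y|^2) and vanishes unless
  x or y lies in the ball, so the integrand is dominated by the indicator of the ball, in x or in y,
  times \<open>levy\<close> of the difference.\<close>

lemma energy_space_Lipschitz:
  fixes \<phi> :: "real ^ 'n \<Rightarrow> real"
  assumes s: "0 < s" "s < 1" and m [measurable]: "\<phi> \<in> borel_measurable borel"
    and C: "\<And>x. \<bar>\<phi> x\<bar> \<le> C" "\<And>x y. \<bar>\<phi> x - \<phi> y\<bar> \<le> C * norm (x - y)"
    and D: "\<And>x. x \<notin> ball c r \<Longrightarrow> \<phi> x = 0"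
  shows "\<phi> \<in> energy_space s"
proof -
  have C0: "0 \<le> C" using C(1)[of 0] by linarith
  define D :: "real ^ 'n \<Rightarrow> real" where "D = indicator (ball c r)"
  have Di: "integrable lborel D"
    using emeasure_bounded_finite[OF bounded_ball, of c r] by (simp add: D_def)
  note Dl = integral_convolution[OF Di levy_integrable[OF s]]
  have [measurable]: "(\<lambda>(x, y). D x * levy s (x - y)) \<in> borel_measurable borel"
    using borel_measurable_integrable[OF Dl] by simp
  have Dl': "integrable lborel (\<lambda>(x, y). D y * levy s (y - x))"
    using integral_swap(2)[of "\<lambda>(x, y). D x * levy s (x - y)"] Dl by simp
  have bd: "frac_integrand s \<phi> \<phi> (x, y) \<le> 4 * C\<^sup>2 * (D x * levy s (x - y) + D y * levy s (y - x))" for x y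
  proof (cases "x \<in> ball c r \<or> y \<in> ball c r")
    case False
    then have "\<phi> x = 0" "\<phi> y = 0" using D by auto
    then show ?thesis by (simp add: frac_integrand_eq D_def)
  next
    case True
    have "\<bar>\<phi> x - \<phi> y\<bar> \<le> 2 * C" using C(1)[of x] C(1)[of y] by linarith
    then have "(\<phi> x - \<phi> y)\<^sup>2 \<le> 4 * C\<^sup>2" using abs_le_square_iff[of "\<phi> x - \<phi> y" "2 * C"] C0 by (simp add: power_mult_distrib)
    moreover have "(\<phi> x - \<phi> y)\<^sup>2 \<le> C\<^sup>2 * (norm (x - y))\<^sup>2"
      using abs_le_square_iff[of "\<phi> x - \<phi> y" "C * norm (x - y)"] C(2)[of x y] C0 by (simp add: power_mult_distrib)
    then have "(\<phi> x - \<phi> y)\<^sup>2 \<le> 4 * C\<^sup>2 * (norm (x - y))\<^sup>2"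
      using mult_nonneg_nonneg[OF zero_le_power2 zero_le_power2, of C "norm (x - y)"] by linarith
    ultimately have "(\<phi> x - \<phi> y)\<^sup>2 \<le> 4 * C\<^sup>2 * min 1 ((norm (x - y))\<^sup>2)"
      by (simp add: min_def)
    then have "frac_integrand s \<phi> \<phi> (x, y) \<le> 4 * C\<^sup>2 * levy s (x - y)"
      unfolding frac_integrand_eq levy_def
      by (simp add: mult_right_mono mult.assoc[symmetric] flip: power2_eq_square)
    also have "levy s (x - y) \<le> D x * levy s (x - y) + D y * levy s (y - x)"
      using True by (auto simp: D_def levy_def norm_minus_commute kern_minus_commute[of s x] indicator_def)
    finally show ?thesis using C0 by (simp add: mult_left_mono)
  qed
  have "integrable lborel (frac_integrand s \<phi> \<phi>)"
  proof (rule Bochner_Integration.integrable_bound)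
    show "integrable lborel (\<lambda>p. 4 * C\<^sup>2 * ((case p of (x, y) \<Rightarrow> D x * levy s (x - y))
      + (case p of (x, y) \<Rightarrow> D y * levy s (y - x))))"
      using Dl Dl' by simp
    show "AE p in lborel. norm (frac_integrand s \<phi> \<phi> p) \<le> norm (4 * C\<^sup>2 * ((case p of (x, y) \<Rightarrow> D x * levy s (x - y))
      + (case p of (x, y) \<Rightarrow> D y * levy s (y - x))))"
    proof (rule AE_I2)
      fix p :: "(real ^ 'n) \<times> (real ^ 'n)"
      obtain x y where p: "p = (x, y)" by (cases p)
      have "0 \<le> frac_integrand s \<phi> \<phi> (x, y)" by (simp add: frac_integrand_eq)
      then show "norm (frac_integrand s \<phi> \<phi> p) \<le> norm (4 * C\<^sup>2 * ((case p of (x, y) \<Rightarrow> D x * levy s (x - y))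
      + (case p of (x, y) \<Rightarrow> D y * levy s (y - x))))"
        using bd[of x y] unfolding p by simp
    qed
  qed measurable
  moreover have "integrable lborel (\<lambda>x. (\<phi> x)\<^sup>2)"
  proof (rule Bochner_Integration.integrable_bound)
    show "integrable lborel (\<lambda>x. C\<^sup>2 * D x)" using Di by simp
    have "(\<phi> x)\<^sup>2 \<le> C\<^sup>2 * D x" for x
      using D[of x] C(1)[of x] C0 abs_le_square_iff[of "\<phi> x" C] by (cases "x \<in> ball c r") (auto simp: D_def)
    then show "AE x in lborel. norm ((\<phi> x)\<^sup>2) \<le> norm (C\<^sup>2 * D x)" by (auto simp: abs_mult D_def)
  qed measurable
  ultimately show ?thesis by (simp add: energy_space_def)
qed

text \<open>A one-sided bound on the second differences is enough, since \<open>v \<ge> 0\<close>. Truncating the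
  kernel near the diagonal makes the two halves of the form separately integrable.\<close>

lemma frac_bilin_le_second_difference:
  fixes \<Phi> v :: "real ^ 'n \<Rightarrow> real"
  assumes s: "0 < s" "s < 1" and \<Phi>: "\<Phi> \<in> energy_space s" "\<And>x. \<bar>\<Phi> x\<bar> \<le> C"
    and v: "v \<in> energy_space s" "\<And>x. 0 \<le> v x" "integrable lborel v"
    and d: "\<And>x h. v x \<noteq> 0 \<Longrightarrow> 2 * \<Phi> x - \<Phi> (x + h) - \<Phi> (x - h) \<le> M * min 1 ((norm h)\<^sup>2)"
    and M: "0 \<le> M"
  shows "frac_bilin s \<Phi> v \<le> M * (\<integral>h. levy s h \<partial>(lborel :: (real ^ 'n) measure)) * (\<integral>x. v x \<partial>lborel)"
proof (rule LIMSEQ_le_const2)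
  have [measurable]: "\<Phi> \<in> borel_measurable borel" "v \<in> borel_measurable borel" using \<Phi> v by auto
  define k :: "nat \<Rightarrow> real ^ 'n \<Rightarrow> real"
    where "k n h = (if 1 / real (Suc n) \<le> norm h then kern s h else 0)" for n h
  have [measurable]: "k n \<in> borel_measurable borel" for n unfolding k_def[abs_def] by measurable
  have k_even: "k n (- h) = k n h" for n h by (simp add: k_def)
  have k0: "0 \<le> k n h" for n h by (simp add: k_def)
  have ki: "integrable lborel (k n)" for n
  proof (rule Bochner_Integration.integrable_bound)
    show "integrable lborel (\<lambda>h :: real ^ 'n. (real (Suc n))\<^sup>2 * levy s h)"
      using levy_integrable[OF s] by simp
    have "k n h \<le> (real (Suc n))\<^sup>2 * levy s h" for h
    proof (cases "1 / real (Suc n) \<le> norm h")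
      case True
      then have "1 \<le> real (Suc n) * norm h" by (simp add: field_simps)
      then have "1 \<le> (real (Suc n) * norm h)\<^sup>2" by (simp add: one_le_power)
      then have "1 \<le> (real (Suc n))\<^sup>2 * min 1 ((norm h)\<^sup>2)"
        by (auto simp: min_def power_mult_distrib)
      then have "1 * kern s h \<le> ((real (Suc n))\<^sup>2 * min 1 ((norm h)\<^sup>2)) * kern s h"
        by (intro mult_right_mono) auto
      then show ?thesis using True by (simp add: k_def levy_def mult.assoc)
    qed (simp add: k_def)
    then show "AE h in lborel. norm (k n h) \<le> norm ((real (Suc n))\<^sup>2 * levy s h)"
      using k0 by simp
  qed measurable
  define F where "F n = (\<lambda>(x, y). (\<Phi> x - \<Phi> y) * v x * k n (x - y))" for n
  have Fm [measurable]: "F n \<in> borel_measurable borel" for n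
    unfolding F_def borel_prod[symmetric] by measurable
  have Fi: "integrable lborel (F n)" for n
  proof (rule Bochner_Integration.integrable_bound)
    show "integrable lborel (\<lambda>p. 2 * C * (case p of (x, y) \<Rightarrow> v x * k n (x - y)))"
      using integral_convolution[OF v(3) ki] by simp
    have "norm (F n (x, y)) \<le> 2 * C * (v x * k n (x - y))" for x y
    proof -
      have "\<bar>\<Phi> x - \<Phi> y\<bar> \<le> 2 * C" using \<Phi>(2)[of x] \<Phi>(2)[of y] by linarith
      then have "\<bar>\<Phi> x - \<Phi> y\<bar> * (v x * k n (x - y)) \<le> 2 * C * (v x * k n (x - y))"
        using v(2) k0 by (intro mult_right_mono) auto
      then show ?thesis using v(2) k0 by (simp add: F_def abs_mult mult.assoc)
    qed
    then show "AE p in lborel. norm (F n p) \<le> norm (2 * C * (case p of (x, y) \<Rightarrow> v x * k n (x - y)))"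
      by (auto intro!: AE_I2 order_trans[OF _ abs_ge_self])
  qed measurable
  \<comment> \<open>Symmetrising in x and y gives back the integrand of the form wherever the kernel
    has not been cut off.\<close>
  define G where "G n = (\<lambda>(x, y). F n (x, y) + F n (y, x))" for n
  have Gint: "(\<integral>p. G n p \<partial>lborel) = 2 * (\<integral>p. F n p \<partial>lborel)" for n
  proof -
    have "(\<integral>p. G n p \<partial>lborel) = (\<integral>p. F n p + (case p of (x, y) \<Rightarrow> F n (y, x)) \<partial>lborel)"
      by (intro Bochner_Integration.integral_cong refl) (auto simp: G_def)
    then show ?thesis using Fi integral_swap[OF Fm, of n] by simp
  qed
  have Geq: "G n (x, y) = (if 1 / real (Suc n) \<le> norm (x - y) then frac_integrand s \<Phi> v (x, y) else 0)" for n x y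
    by (simp add: G_def F_def k_def frac_integrand_eq kern_minus_commute[of s y] norm_minus_commute[of y] algebra_simps)
  show "(\<lambda>n. \<integral>p. G n p \<partial>lborel) \<longlonglongrightarrow> frac_bilin s \<Phi> v"
    unfolding frac_bilin_def
  proof (rule integral_dominated_convergence)
    show "integrable lborel (\<lambda>p. norm (frac_integrand s \<Phi> v p))"
      using integrable_frac_integrand[OF \<Phi>(1) v(1)] by simp
    show "frac_integrand s \<Phi> v \<in> borel_measurable lborel" by measurable
    show "G n \<in> borel_measurable lborel" for n
      unfolding G_def F_def lborel_prod[symmetric] by measurable
    show "AE p in lborel. (\<lambda>n. G n p) \<longlonglongrightarrow> frac_integrand s \<Phi> v p"
    proof (rule AE_I2)
      fix p :: "(real ^ 'n) \<times> (real ^ 'n)"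
      obtain x y where p: "p = (x, y)" by (cases p)
      show "(\<lambda>n. G n p) \<longlonglongrightarrow> frac_integrand s \<Phi> v p"
      proof (cases "x = y")
        case True
        then show ?thesis by (simp add: p Geq frac_integrand_eq)
      next
        case False
        have "(\<lambda>n. 1 / real (Suc n)) \<longlonglongrightarrow> 0" by (rule lim_1_over_n[THEN LIMSEQ_Suc])
        then have "\<forall>\<^sub>F n in sequentially. 1 / real (Suc n) < norm (x - y)"
          using False by (intro order_tendstoD) auto
        then have "\<forall>\<^sub>F n in sequentially. G n p = frac_integrand s \<Phi> v p"
          by eventually_elim (simp add: p Geq)
        then show ?thesis by (rule tendsto_eventually)
      qed
    qed
    show "AE p in lborel. norm (G n p) \<le> norm (frac_integrand s \<Phi> v p)" for n
      by (rule AE_I2) (auto simp: Geq)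
  qed
  define I where "I = (\<integral>h. levy s h \<partial>(lborel :: (real ^ 'n) measure))"
  have "2 * (\<integral>p. F n p \<partial>lborel) \<le> M * I * (\<integral>x. v x \<partial>lborel)" for n
  proof -
    have Fi': "integrable (lborel \<Otimes>\<^sub>M lborel) (F n)" using Fi by (simp add: lborel_prod)
    have hi: "integrable lborel (\<lambda>h. (\<Phi> x - \<Phi> (x + h)) * k n h)" "integrable lborel (\<lambda>h. (\<Phi> x - \<Phi> (x - h)) * k n h)" for x
    proof -
      have "\<bar>\<Phi> x - \<Phi> y\<bar> \<le> 2 * C" for y using \<Phi>(2)[of x] \<Phi>(2)[of y] by linarith
      moreover have "0 \<le> C" using \<Phi>(2)[of x] by linarith
      ultimately have "norm ((\<Phi> x - \<Phi> y) * k n h) \<le> norm (2 * C * k n h)" for y h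
        using k0[of n h] mult_right_mono[of "\<bar>\<Phi> x - \<Phi> y\<bar>" "2 * C" "k n h"] by (simp add: abs_mult)
      note bd = this
      have "integrable lborel (\<lambda>h. (\<Phi> x - \<Phi> (T h)) * k n h)"
        if [measurable]: "T \<in> borel_measurable borel" for T
      proof (rule Bochner_Integration.integrable_bound[of lborel "\<lambda>h. 2 * C * k n h"])
        show "integrable lborel (\<lambda>h. 2 * C * k n h)" using ki[of n] by simp
        show "(\<lambda>h. (\<Phi> x - \<Phi> (T h)) * k n h) \<in> borel_measurable lborel" by measurable
      qed (rule AE_I2, rule bd)
      from this[of "\<lambda>h. x + h"] this[of "\<lambda>h. x - h"]
      show "integrable lborel (\<lambda>h. (\<Phi> x - \<Phi> (x + h)) * k n h)" "integrable lborel (\<lambda>h. (\<Phi> x - \<Phi> (x - h)) * k n h)"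
        by simp_all
    qed
    \<comment> \<open>The inner integral is computed twice, with y = x + h here and y = x - h in the
      next fact; the sum of the two contains the second difference.\<close>
    have in1: "(\<integral>y. F n (x, y) \<partial>lborel) = v x * (\<integral>h. (\<Phi> x - \<Phi> (x + h)) * k n h \<partial>lborel)" for x
    proof -
      have "(\<integral>y. F n (x, y) \<partial>lborel) = (\<integral>h. F n (x, x + h) \<partial>lborel)"
        by (rule integral_lborel_translate(3)[symmetric]) (simp add: F_def, measurable)
      also have "\<dots> = (\<integral>h. v x * ((\<Phi> x - \<Phi> (x + h)) * k n h) \<partial>lborel)"
        by (intro Bochner_Integration.integral_cong refl) (simp add: F_def k_even)
      finally show ?thesis by simp
    qed
    have in2: "(\<integral>y. F n (x, y) \<partial>lborel) = v x * (\<integral>h. (\<Phi> x - \<Phi> (x - h)) * k n h \<partial>lborel)" for x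
    proof -
      have "(\<integral>y. F n (x, y) \<partial>lborel) = (\<integral>h. F n (x, x - h) \<partial>lborel)"
        by (rule integral_lborel_translate(1)[symmetric]) (simp add: F_def, measurable)
      also have "\<dots> = (\<integral>h. v x * ((\<Phi> x - \<Phi> (x - h)) * k n h) \<partial>lborel)"
        by (intro Bochner_Integration.integral_cong refl) (simp add: F_def)
      finally show ?thesis by simp
    qed
    have "2 * (\<integral>y. F n (x, y) \<partial>lborel) \<le> v x * (M * I)" for x
    proof (cases "v x = 0")
      case False
      have "2 * (\<integral>y. F n (x, y) \<partial>lborel)
        = v x * (\<integral>h. (\<Phi> x - \<Phi> (x + h)) * k n h + (\<Phi> x - \<Phi> (x - h)) * k n h \<partial>lborel)"
        unfolding Bochner_Integration.integral_add[OF hi] distrib_left using in1[of x] in2[of x] by linarith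
      also have "(\<integral>h. (\<Phi> x - \<Phi> (x + h)) * k n h + (\<Phi> x - \<Phi> (x - h)) * k n h \<partial>lborel) \<le> (\<integral>h. M * levy s h \<partial>(lborel :: (real ^ 'n) measure))"
      proof (rule integral_mono)
        show "integrable lborel (\<lambda>h. (\<Phi> x - \<Phi> (x + h)) * k n h + (\<Phi> x - \<Phi> (x - h)) * k n h)"
          using hi by simp
        show "integrable lborel (\<lambda>h :: real ^ 'n. M * levy s h)" by (intro integrable_mult_right levy_integrable[OF s])
        fix h
        have "(\<Phi> x - \<Phi> (x + h)) * k n h + (\<Phi> x - \<Phi> (x - h)) * k n h = (2 * \<Phi> x - \<Phi> (x + h) - \<Phi> (x - h)) * k n h"
          by (simp add: algebra_simps)
        also have "\<dots> \<le> (M * min 1 ((norm h)\<^sup>2)) * k n h"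
          using d[OF False] k0 by (intro mult_right_mono)
        also have "\<dots> \<le> M * levy s h"
          using M by (auto simp: k_def levy_def)
        finally show "(\<Phi> x - \<Phi> (x + h)) * k n h + (\<Phi> x - \<Phi> (x - h)) * k n h \<le> M * levy s h" .
      qed
      finally show ?thesis using v(2)[of x] by (simp add: I_def mult_left_mono)
    qed (simp add: F_def)
    then have "(\<integral>x. 2 * (\<integral>y. F n (x, y) \<partial>lborel) \<partial>lborel) \<le> (\<integral>x. v x * (M * I) \<partial>lborel)"
      using v(3) lborel_pair.integrable_fst'[OF Fi'] by (intro integral_mono) auto
    then show ?thesis
      using lborel_pair.integral_fst'[OF Fi'] by (simp add: lborel_prod mult.commute)
  qed
  then show "\<exists>N. \<forall>n\<ge>N. (\<integral>p. G n p \<partial>lborel) \<le> M * (\<integral>h. levy s h \<partial>(lborel :: (real ^ 'n) measure)) * (\<integral>x. v x \<partial>lborel)"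
    by (simp add: Gint I_def)
qed

section \<open>The equation and the maximum principle on small sets\<close>

lemma frac_const_pos: "0 < s \<Longrightarrow> s < 1 \<Longrightarrow> 0 < frac_const N s"
  unfolding frac_const_def by (intro divide_pos_pos mult_pos_pos Gamma_real_pos) auto

section \<open>Compactly supported test functions\<close>

lemma measure_lborel_open_pos:
  fixes U :: "'a::euclidean_space set"
  assumes "open U" "U \<noteq> {}" "emeasure lborel U < \<infinity>"
  shows "0 < measure lborel U"
proof -
  have "\<not> negligible U" using assms open_not_negligible by blast
  then have "emeasure lborel U \<noteq> 0"
    using negligible_iff_null_sets[of U] assms(1) by (auto simp: null_sets_completion_iff null_sets_def)
  then show ?thesis using assms(3) by (simp add: measure_def enn2real_positive_iff zero_less_iff_neq_zero)
qed

lemma compact_support_integrable: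
  fixes g :: "'a::euclidean_space \<Rightarrow> real"
  assumes "compact K" "g \<in> borel_measurable borel" "\<And>x. g x \<noteq> 0 \<Longrightarrow> x \<in> K" "\<And>x. x \<in> K \<Longrightarrow> \<bar>g x\<bar> \<le> C"
  shows "integrable lborel g"
proof (rule Bochner_Integration.integrable_bound)
  have "K \<in> sets borel" using borel_compact[OF assms(1)] .
  then show "integrable lborel (\<lambda>x. C * indicator K x)"
    using emeasure_compact_finite[OF assms(1)] by (intro integrable_mult_right) auto
  have "\<bar>g x\<bar> \<le> \<bar>C * indicator K x\<bar>" for x
  proof (cases "x \<in> K")
    case True
    then show ?thesis using assms(4)[of x] by simp
  next
    case False
    then show ?thesis using assms(3)[of x] by auto
  qed
  then show "AE x in lborel. norm (g x) \<le> norm (C * indicator K x)" by simp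
qed (use assms in simp)

text \<open>Continuity bounds g on the compact set \<open>K\<close>, although g may be unbounded on
  \<Omega>.\<close>

lemma compact_test_integrable:
  fixes g v :: "real ^ 'n \<Rightarrow> real"
  assumes \<Omega>: "open \<Omega>" and g: "continuous_on \<Omega> g" and v [measurable]: "v \<in> borel_measurable borel"
    and C: "\<And>x. \<bar>v x\<bar> \<le> C" and K: "compact K" "K \<subseteq> \<Omega>" "\<And>x. v x \<noteq> 0 \<Longrightarrow> x \<in> K"
  shows "integrable lborel (\<lambda>x. indicator \<Omega> x * g x * v x)"
proof -
  have [measurable]: "(\<lambda>x. indicator \<Omega> x * g x) \<in> borel_measurable borel"
    using borel_measurable_continuous_on_indicator[OF _ g] \<Omega> by simp
  have m: "(\<lambda>x. indicator \<Omega> x * g x * v x) \<in> borel_measurable borel" by measurable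
  have "compact (g ` K)" using K by (intro compact_continuous_image continuous_on_subset[OF g]) auto
  then obtain B where B: "\<And>x. x \<in> K \<Longrightarrow> \<bar>g x\<bar> \<le> B"
    using compact_imp_bounded by (fastforce simp: bounded_iff)
  have "\<bar>indicator \<Omega> x * g x * v x\<bar> \<le> B * C" if "x \<in> K" for x
  proof -
    have "\<bar>g x * v x\<bar> \<le> B * C"
      using B[OF that] C[of x] by (auto simp: abs_mult intro!: mult_mono order_trans[OF abs_ge_zero])
    then show ?thesis using that K(2) by auto
  qed
  then show ?thesis using K by (intro compact_support_integrable[OF K(1) m]) auto
qed

text \<open>Only test functions that are Borel, bounded and compactly supported in \<open>\<Omega>\<close> are needed;
  for these the right-hand side always exists.\<close>

definition compact_weak_solution ::
  "real \<Rightarrow> (real ^ 'n) set \<Rightarrow> (real ^ 'n \<Rightarrow> real \<Rightarrow> real) \<Rightarrow> (real ^ 'n \<Rightarrow> real) \<Rightarrow> bool" where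
  "compact_weak_solution s \<Omega> f u \<longleftrightarrow> u \<in> energy_space s \<and> (\<forall>x. x \<notin> \<Omega> \<longrightarrow> u x = 0) \<and>
     (\<forall>v \<in> energy_space s. bounded (range v) \<longrightarrow> (\<forall>K. compact K \<longrightarrow> K \<subseteq> \<Omega> \<longrightarrow> (\<forall>x. v x \<noteq> 0 \<longrightarrow> x \<in> K) \<longrightarrow>
        frac_const CARD('n) s / 2 * frac_bilin s u v = (\<integral>x. indicator \<Omega> x * f x (u x) * v x \<partial>lborel)))"

lemma continuous_on_comp_u:
  assumes "continuous_on (\<Omega> \<times> UNIV) (\<lambda>(x, a). f x a)" "continuous_on UNIV u"
  shows "continuous_on \<Omega> (\<lambda>x. f x (u x))"
proof -
  have "continuous_on \<Omega> (\<lambda>x. (\<lambda>(x, a). f x a) (x, u x))"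
    by (rule continuous_on_compose2[OF assms(1)])
      (auto intro!: continuous_intros continuous_on_subset[OF assms(2)])
  then show ?thesis by simp
qed

lemma weak_solution_imp_compact:
  fixes u :: "real ^ 'n \<Rightarrow> real"
  assumes \<Omega>: "open \<Omega>" and f: "continuous_on (\<Omega> \<times> UNIV) (\<lambda>(x, a). f x a)"
    and u: "continuous_on UNIV u" and weak: "weak_solution s \<Omega> f u"
  shows "compact_weak_solution s \<Omega> f u"
  unfolding compact_weak_solution_def
proof (intro conjI ballI impI allI)
  have [measurable]: "u \<in> borel_measurable borel" by (rule borel_measurable_continuous_onI[OF u])
  show "u \<in> energy_space s" "\<And>x. x \<notin> \<Omega> \<Longrightarrow> u x = 0"
    using weak frac_sobolev_iff_energy_space[of u s] by (auto simp: weak_solution_def frac_sobolev0_def)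
  fix v :: "real ^ 'n \<Rightarrow> real" and K
  assume v: "v \<in> energy_space s" "bounded (range v)" and K: "compact K" "K \<subseteq> \<Omega>" "\<forall>x. v x \<noteq> 0 \<longrightarrow> x \<in> K"
  have [measurable]: "v \<in> borel_measurable borel" using v by auto
  obtain C where "\<bar>v x\<bar> \<le> C" for x using v(2) by (auto simp: bounded_iff)
  then have i: "integrable lborel (\<lambda>x. indicator \<Omega> x * f x (u x) * v x)"
    using K by (intro compact_test_integrable[OF \<Omega> continuous_on_comp_u[OF f u]]) auto
  have eq: "(\<lambda>x. indicator \<Omega> x *\<^sub>R (f x (u x) * v x)) = (\<lambda>x. indicator \<Omega> x * f x (u x) * v x)"
    by (auto simp: fun_eq_iff)
  note m = borel_measurable_integrable[OF i]
  have "set_integrable lebesgue \<Omega> (\<lambda>x. f x (u x) * v x)"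
    unfolding set_integrable_def eq using i integrable_completion[OF m] by simp
  moreover have "v \<in> frac_sobolev0 s \<Omega>"
    using v(1) K frac_sobolev_iff_energy_space[of v s] by (auto simp: frac_sobolev0_def)
  ultimately have "frac_form s u v = (LINT x:\<Omega>|lebesgue. f x (u x) * v x)"
    using weak by (simp add: weak_solution_def)
  also have "\<dots> = (\<integral>x. indicator \<Omega> x * f x (u x) * v x \<partial>lborel)"
    unfolding set_lebesgue_integral_def eq using integral_completion[OF m] by simp
  finally show "frac_const CARD('n) s / 2 * frac_bilin s u v = (\<integral>x. indicator \<Omega> x * f x (u x) * v x \<partial>lborel)"
    by (simp add: frac_form_eq)
qed

text \<open>Collecting the hypotheses in a locale permits a second instance for the mirror image of
  u, to which all results then apply with planes coming from the other side.\<close>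

locale antisymmetric_solution =
  fixes s :: real and i1 iN :: "'n::finite" and \<Omega> :: "(real ^ 'n) set"
    and f :: "real ^ 'n \<Rightarrow> real \<Rightarrow> real" and u :: "real ^ 'n \<Rightarrow> real"
  assumes s: "0 < s" "s < 1" and i1N: "i1 \<noteq> iN"
    and \<Omega>: "open \<Omega>" "bounded \<Omega>"
    and \<Omega>_scale: "\<And>x t \<tau>. x \<in> \<Omega> \<Longrightarrow> t \<in> {-1..1} \<Longrightarrow> \<tau> \<in> {-1..1} \<Longrightarrow>
           scale_coord i1 t (scale_coord iN \<tau> x) \<in> \<Omega>"
    and f_cont: "continuous_on (\<Omega> \<times> UNIV) (\<lambda>(x, a). f x a)"
    and f_lip: "\<And>K :: real set. bounded K \<Longrightarrow>
           \<exists>L>0. \<forall>a\<in>K. \<forall>b\<in>K. \<forall>x\<in>\<Omega>. \<bar>f x a - f x b\<bar> \<le> L * \<bar>a - b\<bar>"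
    and f_mono: "\<And>a x t. x \<in> \<Omega> \<Longrightarrow> t \<in> {-1..1} \<Longrightarrow> f (scale_coord i1 t x) a \<ge> f x a"
    and weak: "compact_weak_solution s \<Omega> f u"
    and u_cont: "continuous_on UNIV u" and u_bdd: "bounded (range u)"
    and u_anti: "antisymmetric_wrt iN 0 u"
    and u_nonneg: "\<And>x. x \<in> half_space iN 0 \<inter> \<Omega> \<Longrightarrow> u x \<ge> 0"
begin

text \<open>For 0 \<le> l \<le> x_1 the new first coordinate 2l - x_1 lies between -x_1 and x_1, so
  the reflection is one of the admissible scalings. If x_1 = 0, then l = 0 and x is fixed.\<close>

lemma reflect_mem:
  assumes "x \<in> \<Omega>" "0 \<le> l" "l \<le> x $ i1"
  obtains t where "t \<in> {-1..1}" "reflect i1 l x = scale_coord i1 t x" "reflect i1 l x \<in> \<Omega>"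
proof -
  have id: "scale_coord iN 1 x = x" by (simp add: scale_coord_def vec_eq_iff)
  obtain t where t: "t \<in> {-1..1}" "reflect i1 l x = scale_coord i1 t x"
  proof (cases "x $ i1 = 0")
    case True
    then show thesis using assms by (intro that[of 0]) (auto simp: vec_eq_iff reflect_nth scale_coord_def)
  next
    case False
    then have "0 < x $ i1" using assms by simp
    then have "(2 * l - x $ i1) / x $ i1 \<in> {-1..1}" using assms by (auto simp: field_simps)
    then show thesis using False
      by (intro that[of "(2 * l - x $ i1) / x $ i1"]) (auto simp: vec_eq_iff reflect_nth scale_coord_def)
  qed
  then have "reflect i1 l x \<in> \<Omega>" using \<Omega>_scale[OF assms(1) t(1), of 1] by (simp add: id)
  then show thesis using that t by blast
qed

lemma u_borel [measurable]: "u \<in> borel_measurable borel"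
  by (rule borel_measurable_continuous_onI[OF u_cont])

lemma u_outside: "x \<notin> \<Omega> \<Longrightarrow> u x = 0"
  using weak by (simp add: compact_weak_solution_def)

lemma u_energy: "u \<in> energy_space s"
  using weak by (simp add: compact_weak_solution_def)

lemma u_reflect_N: "u (reflect iN 0 x) = - u x"
  using u_anti by (simp add: antisymmetric_wrt_def fun_eq_iff)

lemma u_ge_0: "0 \<le> x $ iN \<Longrightarrow> 0 \<le> u x"
proof (cases "x $ iN = 0")
  case True
  then have "reflect iN 0 x = x" by (simp add: vec_eq_iff reflect_nth)
  then show ?thesis using u_reflect_N[of x] by simp
next
  case False
  assume "0 \<le> x $ iN"
  then show ?thesis using False u_nonneg[of x] u_outside[of x] by (cases "x \<in> \<Omega>") (auto simp: half_space_def)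
qed

lemma ex_Lipschitz: "\<exists>L>0. \<forall>x\<in>\<Omega>. \<forall>y z. \<bar>f x (u y) - f x (u z)\<bar> \<le> L * \<bar>u y - u z\<bar>"
  using f_lip[OF u_bdd] by auto

text \<open>A Lipschitz constant for values in the bounded range of u. It does not depend on the
  plane, so the smallness threshold derived from it serves all planes at once.\<close>

definition L :: real where
  "L = (SOME L. 0 < L \<and> (\<forall>x\<in>\<Omega>. \<forall>y z. \<bar>f x (u y) - f x (u z)\<bar> \<le> L * \<bar>u y - u z\<bar>))"

lemma L_pos: "0 < L" and L: "x \<in> \<Omega> \<Longrightarrow> \<bar>f x (u y) - f x (u z)\<bar> \<le> L * \<bar>u y - u z\<bar>"
  using someI_ex[OF ex_Lipschitz] by (auto simp: L_def)

definition c :: real where "c = frac_const CARD('n) s / 2"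

lemma c_pos: "0 < c"
  using frac_const_pos[OF s] by (simp add: c_def)

section \<open>The differences w_l and their differential inequality\<close>

definition w :: "real \<Rightarrow> real ^ 'n \<Rightarrow> real" where
  "w l x = u (reflect i1 l x) - u x"

lemma w_cont: "continuous_on S (w l)"
  unfolding w_def
  by (intro continuous_intros continuous_on_compose2[OF u_cont] continuous_on_subset[OF u_cont]) auto

lemma w_borel [measurable]: "w l \<in> borel_measurable borel"
  by (rule borel_measurable_continuous_onI[OF w_cont])

lemma w_energy: "w l \<in> energy_space s"
  unfolding w_def[abs_def] by (intro energy_space_diff energy_space_reflect u_energy)

lemma double_reflection: "double_reflection i1 iN s"
  by unfold_locales (use i1N s in auto)

abbreviation Q :: "real \<Rightarrow> (real ^ 'n) set" where
  "Q l \<equiv> double_reflection.Q i1 iN l"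

lemma Q_def: "Q l = {x. l < x $ i1 \<and> 0 < x $ iN}"
  by (rule double_reflection.Q_def[OF double_reflection])

lemma w_odd2: "double_reflection.odd2 i1 iN l (w l)"
  by (simp add: double_reflection.odd2_def[OF double_reflection] w_def u_reflect_N reflect_commute[OF i1N])

text \<open>Off \<Omega> the subtracted term is 0, and the reflection in x_1 keeps x_N, hence lands
  where u \<ge> 0. In Q, negative values of w_l can thus occur only inside \<Omega>.\<close>

lemma w_outside:
  assumes "x \<notin> \<Omega>" "0 \<le> x $ iN"
  shows "0 \<le> w l x"
  using u_ge_0[of "reflect i1 l x"] u_outside[of x] assms i1N by (simp add: w_def reflect_nth)

lemma w_bounded: obtains B where "\<And>l x. \<bar>w l x\<bar> \<le> B"
proof -
  obtain b where b: "\<bar>u x\<bar> \<le> b" for x using u_bdd by (auto simp: bounded_iff)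
  have "\<bar>w l x\<bar> \<le> 2 * b" for l x
    using b[of x] b[of "reflect i1 l x"] by (simp add: w_def)
  then show thesis using that by blast
qed

definition F :: "real ^ 'n \<Rightarrow> real" where
  "F x = indicator \<Omega> x * f x (u x)"

lemma f_u_cont: "continuous_on \<Omega> (\<lambda>x. f x (u x))"
  by (rule continuous_on_comp_u[OF f_cont u_cont])

lemma F_borel [measurable]: "F \<in> borel_measurable borel"
  using borel_measurable_continuous_on_indicator[OF _ f_u_cont] \<Omega>(1) by (simp add: F_def[abs_def])

lemma weak_form:
  assumes v: "v \<in> energy_space s" "\<And>x. \<bar>v x\<bar> \<le> C" and K: "compact K" "K \<subseteq> \<Omega>" "\<And>x. v x \<noteq> 0 \<Longrightarrow> x \<in> K"
  shows "integrable lborel (\<lambda>x. F x * v x)" and "c * frac_bilin s u v = (\<integral>x. F x * v x \<partial>lborel)"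
proof -
  have "v \<in> borel_measurable borel" using v by auto
  then show "integrable lborel (\<lambda>x. F x * v x)"
    unfolding F_def by (rule compact_test_integrable[OF \<Omega>(1) f_u_cont _ v(2) K])
  have "bounded (range v)" using v(2) by (auto simp: bounded_iff)
  then show "c * frac_bilin s u v = (\<integral>x. F x * v x \<partial>lborel)"
    using weak v(1) K by (simp add: compact_weak_solution_def c_def F_def)
qed

text \<open>The equation is tested with v and with the reflected v, and the two are subtracted.
  Passing from x to its reflection does not decrease f at a fixed second argument, and changing the
  second argument costs at most L |w_l|.\<close>

lemma w_form_ge:
  assumes l: "0 \<le> l" and v: "v \<in> energy_space s" "\<And>x. 0 \<le> v x" "\<And>x. v x \<le> C"
    and K: "compact K" "K \<subseteq> \<Omega>" "\<And>x. x \<in> K \<Longrightarrow> l \<le> x $ i1" "\<And>x. v x \<noteq> 0 \<Longrightarrow> x \<in> K"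
  shows "integrable lborel (\<lambda>x. \<bar>w l x\<bar> * v x)"
    and "- L * (\<integral>x. \<bar>w l x\<bar> * v x \<partial>lborel) \<le> c * frac_bilin s (w l) v"
proof -
  have [measurable]: "v \<in> borel_measurable borel" using v by auto
  obtain B where B: "\<And>x. \<bar>w l x\<bar> \<le> B" using w_bounded by metis
  have "\<bar>\<bar>w l x\<bar> * v x\<bar> \<le> B * C" for x
    using B[of x] v(2,3)[of x] by (auto simp: abs_mult intro!: mult_mono order_trans[OF abs_ge_zero])
  then show wi: "integrable lborel (\<lambda>x. \<bar>w l x\<bar> * v x)"
    using K by (intro compact_support_integrable[of K]) auto
  have vC: "\<bar>v x\<bar> \<le> C" for x using v by simp
  note v1 = weak_form[OF v(1) vC K(1,2,4)]
  define v' where "v' x = v (reflect i1 l x)" for x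
  have v': "v' \<in> energy_space s" unfolding v'_def[abs_def] by (rule energy_space_reflect[OF v(1)])
  define K' where "K' = reflect i1 l ` K"
  have K': "compact K'" "K' \<subseteq> \<Omega>" "\<And>x. v' x \<noteq> 0 \<Longrightarrow> x \<in> K'"
  proof -
    show "compact K'" unfolding K'_def using K(1) by (intro compact_continuous_image continuous_intros)
    show "K' \<subseteq> \<Omega>" unfolding K'_def using K(2,3) l by (auto elim!: reflect_mem[rotated 2])
    show "x \<in> K'" if "v' x \<noteq> 0" for x
      using K(4)[of "reflect i1 l x"] that unfolding K'_def v'_def by (intro image_eqI[of _ _ "reflect i1 l x"]) auto
  qed
  have v'C: "\<bar>v' x\<bar> \<le> C" for x using vC by (simp add: v'_def)
  note v2 = weak_form[OF v' v'C K']
  have "(\<lambda>x. F x * v' x) \<in> borel_measurable borel" using v' by auto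
  note v3 = integral_lborel_reflect[OF this, of i1 l]
  have i: "integrable lborel (\<lambda>x. F (reflect i1 l x) * v x)" "(\<integral>x. F (reflect i1 l x) * v x \<partial>lborel) = c * frac_bilin s u v'"
    using v2 v3 by (simp_all add: v'_def[abs_def])
  have "- L * (\<integral>x. \<bar>w l x\<bar> * v x \<partial>lborel) = (\<integral>x. - L * (\<bar>w l x\<bar> * v x) \<partial>lborel)"
    using wi by simp
  also have "\<dots> \<le> (\<integral>x. F (reflect i1 l x) * v x - F x * v x \<partial>lborel)"
  proof (rule integral_mono)
    show "integrable lborel (\<lambda>x. - L * (\<bar>w l x\<bar> * v x))" using wi by simp
    show "integrable lborel (\<lambda>x. F (reflect i1 l x) * v x - F x * v x)" using i v1 by simp
    fix x
    have "- L * \<bar>w l x\<bar> * v x \<le> (F (reflect i1 l x) - F x) * v x"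
    proof (cases "v x = 0")
      case False
      then have x: "x \<in> \<Omega>" "l \<le> x $ i1" using K by auto
      then obtain t where t: "t \<in> {-1..1}" "reflect i1 l x = scale_coord i1 t x" "reflect i1 l x \<in> \<Omega>"
        using reflect_mem l by metis
      have "f x (u (reflect i1 l x)) \<le> f (reflect i1 l x) (u (reflect i1 l x))"
        using f_mono[OF x(1) t(1)] by (simp add: t(2))
      moreover have "\<bar>f x (u (reflect i1 l x)) - f x (u x)\<bar> \<le> L * \<bar>w l x\<bar>"
        using L[OF x(1)] by (simp add: w_def)
      ultimately have "- L * \<bar>w l x\<bar> \<le> F (reflect i1 l x) - F x"
        using x t by (simp add: F_def)
      then show ?thesis using v(2) by (intro mult_right_mono)
    qed simp
    then show "- L * (\<bar>w l x\<bar> * v x) \<le> F (reflect i1 l x) * v x - F x * v x"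
      by (simp add: algebra_simps)
  qed
  also have "\<dots> = c * frac_bilin s u v' - c * frac_bilin s u v" using i v1 by simp
  also have "\<dots> = c * (frac_bilin s u v' - frac_bilin s u v)" by (simp add: right_diff_distrib)
  also have "frac_bilin s u v' - frac_bilin s u v = frac_bilin s (w l) v"
    using frac_bilin_diff_left[OF energy_space_reflect[OF u_energy] u_energy v(1), of i1 l]
      frac_bilin_reflect[of u v s i1 l]
    by (simp add: w_def[abs_def] v'_def[abs_def])
  finally show "- L * (\<integral>x. \<bar>w l x\<bar> * v x \<partial>lborel) \<le> c * frac_bilin s (w l) v" .
qed

text \<open>For v the negative part lowered by \<epsilon>, smallness of the support makes the energy
  of v at least 2L/c times the integral of v^2, whereas c times this energy is at most L times the
  integral of v^2 + \<epsilon> v. Hence the integral of v^2 is at most \<epsilon> times that of v,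
  which fails for small \<epsilon> if w_l is negative somewhere on Q.\<close>

lemma weak_maximum_principle:
  obtains \<delta> where "0 < \<delta>"
    "\<And>l. 0 \<le> l \<Longrightarrow> emeasure lborel {x \<in> Q l. w l x < 0} \<le> ennreal \<delta> \<Longrightarrow> \<forall>x\<in>Q l. 0 \<le> w l x"
proof -
  \<comment> \<open>The factor 2 leaves L times the integral of v^2 after the Lipschitz term has
    been absorbed.\<close>
  have pos: "0 < 2 * L / c" using L_pos c_pos by simp
  obtain \<delta> where \<delta>: "0 < \<delta>" "\<And>v :: real ^ 'n \<Rightarrow> real. v \<in> energy_space s \<Longrightarrow>
      emeasure lborel {x. v x \<noteq> 0} \<le> ennreal \<delta> \<Longrightarrow> 2 * L / c * (\<integral>x. (v x)\<^sup>2 \<partial>lborel) \<le> frac_bilin s v v"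
    using frac_bilin_ge_small_support[OF s(1) pos, where 'n = 'n] by blast
  show thesis
  proof (rule that[OF \<delta>(1)], rule ccontr)
    fix l :: real
    assume l: "0 \<le> l" and small: "emeasure lborel {x \<in> Q l. w l x < 0} \<le> ennreal \<delta>"
      and "\<not> (\<forall>x\<in>Q l. 0 \<le> w l x)"
    then obtain x0 where x0: "x0 \<in> Q l" "w l x0 < 0" by force
    interpret D: double_reflection i1 iN l s by (rule double_reflection)
    define m where "m = - w l x0"
    have m: "0 < m" using x0 by (simp add: m_def)
    define U where "U = Q l \<inter> {x. w l x < - m / 2}"
    have U: "open U" "x0 \<in> U"
      using x0 m D.open_Q open_Collect_less[OF w_cont continuous_on_const, of l "- m / 2"]
      by (auto simp: U_def m_def)
    have U\<Omega>: "U \<subseteq> \<Omega>" using w_outside[of _ l] m by (force simp: U_def D.Q_def)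
    have Ufin: "emeasure lborel U < \<infinity>"
      using emeasure_bounded_finite[OF bounded_subset[OF \<Omega>(2) U\<Omega>]] by simp
    have \<Omega>fin: "emeasure lborel \<Omega> < \<infinity>" using emeasure_bounded_finite[OF \<Omega>(2)] by simp
    have [measurable]: "U \<in> sets borel" "\<Omega> \<in> sets borel" using U \<Omega> by auto
    have Upos: "0 < measure lborel U"
      using U Ufin by (intro measure_lborel_open_pos) auto
    have key: "(\<integral>x. (D.neg \<epsilon> (w l) x)\<^sup>2 \<partial>lborel) \<le> \<epsilon> * (\<integral>x. D.neg \<epsilon> (w l) x \<partial>lborel)"
        "integrable lborel (D.neg \<epsilon> (w l))" if e: "0 < \<epsilon>" for \<epsilon>
    proof -
      define v where "v = D.neg \<epsilon> (w l)"
      have vE: "v \<in> energy_space s" unfolding v_def using e by (intro D.neg_energy_space w_odd2 w_energy) simp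
      obtain B where B: "\<And>x. \<bar>w l x\<bar> \<le> B" using w_bounded by metis
      have vB: "v x \<le> B" for x using B[of x] e by (auto simp: v_def D.neg_def)
      \<comment> \<open>Closed half spaces instead of Q make this set closed. It lies in \<Omega>
        because w_l \<ge> 0 outside \<Omega> when x_N \<ge> 0, whereas here w_l \<le> -\<epsilon> <
        0.\<close>
      define K where "K = {x. l \<le> x $ i1} \<inter> {x. 0 \<le> x $ iN} \<inter> {x. \<epsilon> \<le> - w l x}"
      have "closed K" unfolding K_def
        by (intro closed_Int closed_Collect_le continuous_intros w_cont)
      moreover have K\<Omega>: "K \<subseteq> \<Omega>" using w_outside[of _ l] e by (force simp: K_def)
      ultimately have K: "compact K" using bounded_subset[OF \<Omega>(2)] by (auto simp: compact_eq_bounded_closed)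
      have vK: "x \<in> K" if "v x \<noteq> 0" for x
        using that by (auto simp: v_def D.neg_def K_def D.Q_def max_def split: if_splits)
      have "\<bar>v x\<bar> \<le> B" for x using vB by (simp add: v_def)
      then have vi: "integrable lborel v" using vE vK by (intro compact_support_integrable[OF K]) auto
      have v0: "0 \<le> v x" for x by (simp add: v_def)
      note wf = w_form_ge[OF l vE v0 vB K K\<Omega> _ vK]
      have "{x. v x \<noteq> 0} \<subseteq> {x \<in> Q l. w l x < 0}" using e by (auto simp: v_def D.neg_def max_def split: if_splits)
      then have "emeasure lborel {x. v x \<noteq> 0} \<le> ennreal \<delta>"
        by (intro order_trans[OF emeasure_mono small]) auto
      then have p: "2 * L / c * (\<integral>x. (v x)\<^sup>2 \<partial>lborel) \<le> frac_bilin s v v" using \<delta>(2) vE by blast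
      have "frac_bilin s (w l) v \<le> - frac_bilin s v v"
        using D.frac_bilin_neg_le[OF w_odd2 less_imp_le[OF e] w_energy vi[unfolded v_def], of "{}" 0]
        by (simp add: v_def)
      also have "\<dots> \<le> - (2 * L / c * (\<integral>x. (v x)\<^sup>2 \<partial>lborel))" using p by simp
      finally have "c * frac_bilin s (w l) v \<le> c * - (2 * L / c * (\<integral>x. (v x)\<^sup>2 \<partial>lborel))"
        using c_pos by (intro mult_left_mono) auto
      also have "\<dots> = - (2 * L * (\<integral>x. (v x)\<^sup>2 \<partial>lborel))" using c_pos by simp
      finally have 1: "2 * L * (\<integral>x. (v x)\<^sup>2 \<partial>lborel) \<le> L * (\<integral>x. \<bar>w l x\<bar> * v x \<partial>lborel)"
        using wf(2) by (simp add: K_def)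
      have "(\<integral>x. \<bar>w l x\<bar> * v x \<partial>lborel) = (\<integral>x. (v x)\<^sup>2 + \<epsilon> * v x \<partial>lborel)"
      proof (intro Bochner_Integration.integral_cong refl)
        fix x show "\<bar>w l x\<bar> * v x = (v x)\<^sup>2 + \<epsilon> * v x"
          using e by (auto simp: v_def D.neg_def max_def power2_eq_square algebra_simps)
      qed
      also have "\<dots> = (\<integral>x. (v x)\<^sup>2 \<partial>lborel) + \<epsilon> * (\<integral>x. v x \<partial>lborel)"
        using energy_spaceD(2)[OF vE] vi by simp
      finally have "L * (\<integral>x. (v x)\<^sup>2 \<partial>lborel) \<le> L * (\<epsilon> * (\<integral>x. v x \<partial>lborel))" using 1 by (simp add: algebra_simps)
      then show "(\<integral>x. (D.neg \<epsilon> (w l) x)\<^sup>2 \<partial>lborel) \<le> \<epsilon> * (\<integral>x. D.neg \<epsilon> (w l) x \<partial>lborel)"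
        using L_pos by (simp add: v_def)
      show "integrable lborel (D.neg \<epsilon> (w l))" using vi by (simp add: v_def)
    qed
    \<comment> \<open>The integral of v^2 - \<epsilon> v is at least a - \<epsilon>^2 b: on U one
      has v \<ge> 3m/8 and v - \<epsilon> \<ge> m/4, and elsewhere in \<Omega> at most \<epsilon>^2
      is lost. The choice of \<epsilon> keeps the loss below a/2, and b + 1 in place of b keeps the
      denominator positive.\<close>
    define a b where "a = measure lborel U * (m\<^sup>2 / 16)" and "b = measure lborel \<Omega>"
    have ab: "0 < a" "0 \<le> b" using Upos m by (auto simp: a_def b_def)
    define \<epsilon> where "\<epsilon> = min 1 (min (m / 8) (a / (2 * (b + 1))))"
    have "\<epsilon> = 1 \<or> \<epsilon> = m / 8 \<or> \<epsilon> = a / (2 * (b + 1))" by (auto simp: \<epsilon>_def min_def)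
    then have e0: "0 < \<epsilon>" using m ab by auto
    have e: "0 < \<epsilon>" "\<epsilon> \<le> 1" "\<epsilon> \<le> m / 8" "\<epsilon> \<le> a / (2 * (b + 1))"
      by (fact e0) (simp_all only: \<epsilon>_def min.cobounded1 min.cobounded2 min.coboundedI2)
    define v where "v = D.neg \<epsilon> (w l)"
    have vE: "v \<in> energy_space s" unfolding v_def using e by (intro D.neg_energy_space w_odd2 w_energy) simp
    have vi: "integrable lborel v" "integrable lborel (\<lambda>x. (v x)\<^sup>2)"
      using key(2)[OF e(1)] energy_spaceD(2)[OF vE] by (simp_all add: v_def)
    have "(\<integral>x. m\<^sup>2 / 16 * indicator U x - \<epsilon>\<^sup>2 * indicator \<Omega> x \<partial>lborel) \<le> (\<integral>x. (v x)\<^sup>2 - \<epsilon> * v x \<partial>lborel)"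
    proof (rule integral_mono)
      show "integrable lborel (\<lambda>x. m\<^sup>2 / 16 * indicator U x - \<epsilon>\<^sup>2 * indicator \<Omega> x)" using Ufin \<Omega>fin by simp
      show "integrable lborel (\<lambda>x. (v x)\<^sup>2 - \<epsilon> * v x)" using vi by simp
      fix x
      show "m\<^sup>2 / 16 * indicator U x - \<epsilon>\<^sup>2 * indicator \<Omega> x \<le> (v x)\<^sup>2 - \<epsilon> * v x"
      proof (cases "x \<in> U")
        case True
        then have "3 * m / 8 \<le> v x" using e m by (simp add: U_def v_def D.neg_def)
        then have "3 * m / 8 * (m / 4) \<le> v x * (v x - \<epsilon>)" using e m by (intro mult_mono) auto
        moreover have "m\<^sup>2 / 16 \<le> 3 * m / 8 * (m / 4)" using m by (simp add: power2_eq_square)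
        ultimately have "m\<^sup>2 / 16 \<le> v x * (v x - \<epsilon>)" by linarith
        also have "\<dots> = (v x)\<^sup>2 - \<epsilon> * v x" by (simp add: power2_eq_square algebra_simps)
        finally have "m\<^sup>2 / 16 - \<epsilon>\<^sup>2 \<le> (v x)\<^sup>2 - \<epsilon> * v x" using zero_le_power2[of \<epsilon>] by linarith
        then show ?thesis using True U\<Omega> by (simp add: subsetD)
      next
        case False
        have v\<Omega>: "v x = 0" if "x \<notin> \<Omega>" using w_outside[OF that, of l] e by (auto simp: v_def D.neg_def D.Q_def)
        have "- \<epsilon>\<^sup>2 \<le> (v x)\<^sup>2 - \<epsilon> * v x"
        proof -
          have "0 \<le> \<epsilon> * v x" using e by (simp add: v_def)
          moreover have "2 * v x * \<epsilon> = 2 * (\<epsilon> * v x)" by simp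
          ultimately show ?thesis using sum_squares_bound[of "v x" \<epsilon>] by linarith
        qed
        then show ?thesis using False v\<Omega> by (cases "x \<in> \<Omega>") auto
      qed
    qed
    also have "\<dots> \<le> 0" using key(1)[OF e(1)] vi by (simp add: v_def)
    finally have "a \<le> \<epsilon>\<^sup>2 * b" using Ufin \<Omega>fin by (simp add: a_def b_def mult.commute)
    also have "\<dots> \<le> \<epsilon> * (b + 1)"
      using e ab mult_left_mono[of \<epsilon> 1 \<epsilon>] by (intro mult_mono) (auto simp: power2_eq_square)
    also have "\<dots> \<le> a / (2 * (b + 1)) * (b + 1)" using e ab by (intro mult_right_mono) auto
    also have "\<dots> = a / 2" using ab by (simp add: field_simps)
    finally show False using ab by simp
  qed
qed

end

section \<open>The strong maximum principle\<close>

text \<open>The positive part of the paraboloid 1 - |x - a|^2 / r^2. Its kink at radius r is convex,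
  so second differences are bounded on the side that is needed although the function is not
  differentiable there.\<close>

definition bump :: "real \<Rightarrow> real ^ 'n \<Rightarrow> real ^ 'n \<Rightarrow> real" where
  "bump r a x = 1 - (min r (norm (x - a)))\<^sup>2 / r\<^sup>2"

lemma bump_bounds:
  assumes "0 < r" shows "0 \<le> bump r a x" "bump r a x \<le> 1"
proof -
  have "(min r (norm (x - a)))\<^sup>2 \<le> r\<^sup>2" using assms by (intro power_mono) auto
  then show "0 \<le> bump r a x" using assms by (simp add: bump_def)
qed (simp add: bump_def)

lemma bump_eq_0: "0 < r \<Longrightarrow> r \<le> norm (x - a) \<Longrightarrow> bump r a x = 0"
  by (simp add: bump_def min_absorb1)

lemma bump_center [simp]: "0 < r \<Longrightarrow> bump r a a = 1"
  by (simp add: bump_def)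

lemma bump_eq: "norm (x - a) \<le> r \<Longrightarrow> bump r a x = 1 - (norm (x - a))\<^sup>2 / r\<^sup>2"
  by (simp add: bump_def min_absorb2)

lemma bump_ge:
  assumes "0 < r" shows "1 - (norm (x - a))\<^sup>2 / r\<^sup>2 \<le> bump r a x"
proof -
  have "(min r (norm (x - a)))\<^sup>2 \<le> (norm (x - a))\<^sup>2" using assms by (intro power_mono) auto
  then show ?thesis using assms by (simp add: bump_def divide_right_mono)
qed

lemma bump_reflect: "bump r a (reflect i l x) = bump r (reflect i l a) x"
  by (simp add: bump_def norm_reflect_diff)

lemma bump_cont: "0 < r \<Longrightarrow> continuous_on S (bump r a)"
  unfolding bump_def by (intro continuous_intros) auto

lemma bump_Lipschitz:
  assumes r: "0 < r"
  shows "\<bar>bump r a x - bump r a y\<bar> \<le> 2 / r * norm (x - y)"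
proof -
  define p where "p = min r (norm (x - a))"
  define q where "q = min r (norm (y - a))"
  have pq: "0 \<le> p" "p \<le> r" "0 \<le> q" "q \<le> r" using r by (auto simp: p_def q_def)
  have "\<bar>norm (x - a) - norm (y - a)\<bar> \<le> norm (x - y)"
    using norm_triangle_ineq3[of "x - a" "y - a"] by simp
  then have d: "\<bar>p - q\<bar> \<le> norm (x - y)" by (auto simp: p_def q_def min_def)
  have "\<bar>q\<^sup>2 - p\<^sup>2\<bar> = \<bar>p - q\<bar> * (p + q)"
    using pq by (simp add: power2_eq_square abs_mult[symmetric] square_diff_square_factored abs_minus_commute)
      (simp add: abs_mult abs_minus_commute mult.commute)
  also have "\<dots> \<le> norm (x - y) * (2 * r)" using d pq by (intro mult_mono) auto
  finally have "\<bar>q\<^sup>2 - p\<^sup>2\<bar> / r\<^sup>2 \<le> norm (x - y) * (2 * r) / r\<^sup>2" by (intro divide_right_mono) auto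
  moreover have "\<bar>bump r a x - bump r a y\<bar> = \<bar>q\<^sup>2 - p\<^sup>2\<bar> / r\<^sup>2"
    by (simp add: bump_def p_def[symmetric] q_def[symmetric] diff_divide_distrib[symmetric])
  moreover have "norm (x - y) * (2 * r) / r\<^sup>2 = 2 / r * norm (x - y)"
    using r by (simp add: power2_eq_square)
  ultimately show ?thesis by simp
qed

lemma bump_energy_space:
  fixes a :: "real ^ 'n"
  assumes "0 < s" "s < 1" "0 < r"
  shows "bump r a \<in> energy_space s"
proof (rule energy_space_Lipschitz[OF assms(1,2)])
  show "bump r a \<in> borel_measurable borel"
    using bump_cont[OF assms(3)] by (rule borel_measurable_continuous_onI)
  fix x y :: "real ^ 'n"
  show "\<bar>bump r a x\<bar> \<le> max 1 (2 / r)" using bump_bounds[OF assms(3), of a x] by simp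
  have "2 / r * norm (x - y) \<le> max 1 (2 / r) * norm (x - y)" by (intro mult_right_mono) auto
  then show "\<bar>bump r a x - bump r a y\<bar> \<le> max 1 (2 / r) * norm (x - y)"
    using bump_Lipschitz[OF assms(3), of a x y] by linarith
  show "bump r a x = 0" if "x \<notin> ball a r"
    using that assms(3) by (intro bump_eq_0) (auto simp: dist_norm norm_minus_commute)
qed

text \<open>At x the bump equals the paraboloid and everywhere else it lies above it; for the
  paraboloid the parallelogram law gives the second difference exactly.\<close>

lemma bump_second_difference:
  assumes r: "0 < r" and x: "norm (x - a) < r"
  shows "2 * bump r a x - bump r a (x + h) - bump r a (x - h) \<le> 2 / r\<^sup>2 * (norm h)\<^sup>2"
proof -
  have "(norm ((x - a) + h))\<^sup>2 + (norm ((x - a) - h))\<^sup>2 = 2 * (norm (x - a))\<^sup>2 + 2 * (norm h)\<^sup>2"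
    by (simp add: power2_norm_eq_inner inner_add_left inner_add_right inner_diff_left inner_diff_right inner_commute)
  then have "(norm (x + h - a))\<^sup>2 / r\<^sup>2 + (norm (x - h - a))\<^sup>2 / r\<^sup>2
      = 2 * ((norm (x - a))\<^sup>2 / r\<^sup>2) + 2 / r\<^sup>2 * (norm h)\<^sup>2"
    by (simp add: add_divide_distrib[symmetric] algebra_simps)
  then show ?thesis
    using bump_ge[OF r, of "x + h" a] bump_ge[OF r, of "x - h" a] bump_eq[of x a r] x by linarith
qed

section \<open>Odd bumps and a positive lower bound for the folded kernel\<close>

context double_reflection
begin

definition odd_bump :: "real \<Rightarrow> real ^ 'n \<Rightarrow> real ^ 'n \<Rightarrow> real" where
  "odd_bump r a x = bump r a x - bump r (reflect i l a) x - bump r (reflect j 0 a) x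
     + bump r (reflect i l (reflect j 0 a)) x"

lemma odd_bump_odd2: "odd2 (odd_bump r a)"
  using ij by (simp add: odd2_def odd_bump_def bump_reflect reflect_commute[of i j])

lemma odd_bump_cont: "0 < r \<Longrightarrow> continuous_on S (odd_bump r a)"
  unfolding odd_bump_def by (intro continuous_intros bump_cont)

lemma odd_bump_energy_space: "s < 1 \<Longrightarrow> 0 < r \<Longrightarrow> odd_bump r a \<in> energy_space s"
  unfolding odd_bump_def[abs_def]
  by (intro energy_space_add energy_space_diff bump_energy_space s)

lemma odd_bump_abs_le: "0 < r \<Longrightarrow> \<bar>odd_bump r a x\<bar> \<le> 4"
  unfolding odd_bump_def
  using bump_bounds[of r a x] bump_bounds[of r "reflect i l a" x] bump_bounds[of r "reflect j 0 a" x]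
    bump_bounds[of r "reflect i l (reflect j 0 a)" x] by linarith

lemma odd_bump_eq:
  assumes r: "0 < r" and a: "ball a r \<subseteq> Q" and x: "x \<in> Q"
  shows "odd_bump r a x = bump r a x"
proof -
  have *: "bump r a y = 0" if "y \<notin> Q" for y
    using that a r by (intro bump_eq_0) (force simp: dist_norm norm_minus_commute)+
  have "bump r a (reflect i l x) = 0" "bump r a (reflect j 0 x) = 0"
    "bump r a (reflect j 0 (reflect i l x)) = 0"
    using reflect_notin_Q[of x] x reflect_commute[OF ij, of l 0 x] by (auto intro!: * simp: Q_def)
  then show ?thesis by (simp add: odd_bump_def bump_reflect)
qed

text \<open>The copies with a minus sign have concave kinks and would spoil a one-sided bound. For
  |h| < r, however, x + h and x - h stay in \<open>Q\<close>, where only the central bump is seen.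
  For |h| \<ge> r the bound 4 on the function gives 16, and min(1, |h|^2) \<ge> r^2.\<close>

lemma odd_bump_second_difference:
  assumes r: "0 < r" "r \<le> 1" and a: "cball a (2 * r) \<subseteq> Q" and x: "norm (x - a) < r"
  shows "2 * odd_bump r a x - odd_bump r a (x + h) - odd_bump r a (x - h) \<le> 16 / r\<^sup>2 * min 1 ((norm h)\<^sup>2)"
proof (cases "norm h < r")
  case True
  have b: "ball a r \<subseteq> Q" using a r by (force simp: subset_iff)
  have "norm (x + h - a) \<le> norm (x - a) + norm h" "norm (x - h - a) \<le> norm (x - a) + norm h"
    using norm_triangle_ineq[of "x - a" h] norm_triangle_ineq4[of "x - a" h] by (simp_all add: algebra_simps)
  then have "x \<in> Q" "x + h \<in> Q" "x - h \<in> Q"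
    using x True r by (auto intro!: subsetD[OF a] simp: dist_norm norm_minus_commute[of a])
  then have "2 * odd_bump r a x - odd_bump r a (x + h) - odd_bump r a (x - h) \<le> 2 / r\<^sup>2 * (norm h)\<^sup>2"
    using bump_second_difference[OF r(1) x, of h] by (simp add: odd_bump_eq[OF r(1) b])
  also have "\<dots> \<le> 16 / r\<^sup>2 * (norm h)\<^sup>2" by (intro mult_right_mono divide_right_mono) auto
  also have "(norm h)\<^sup>2 = min 1 ((norm h)\<^sup>2)"
    using True r power_le_one[of "norm h" 2] by (simp add: min_def)
  finally show ?thesis .
next
  case False
  have "r\<^sup>2 \<le> min 1 ((norm h)\<^sup>2)"
    using False r power_mono[of r "norm h" 2] power_le_one[of r 2] by simp
  then have "16 / r\<^sup>2 * r\<^sup>2 \<le> 16 / r\<^sup>2 * min 1 ((norm h)\<^sup>2)" by (intro mult_left_mono) auto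
  moreover have "16 / r\<^sup>2 * r\<^sup>2 = 16" using r by simp
  moreover have "2 * odd_bump r a x - odd_bump r a (x + h) - odd_bump r a (x - h) \<le> 16"
    using odd_bump_abs_le[OF r(1), of a x] odd_bump_abs_le[OF r(1), of a "x + h"] odd_bump_abs_le[OF r(1), of a "x - h"]
    by linarith
  ultimately show ?thesis by linarith
qed

text \<open>Disjointness keeps the pairs away from the singularity of the kernel, so the continuous
  positive function \<open>K\<close> attains a positive minimum.\<close>

lemma K_lower_bound:
  assumes "compact A" "compact B" "A \<subseteq> Q" "B \<subseteq> Q" "A \<inter> B = {}"
  obtains k where "0 < k" "\<And>x y. x \<in> A \<Longrightarrow> y \<in> B \<Longrightarrow> k \<le> K x y"
proof (cases "A \<times> B = {}")
  case True
  then show thesis using that[of 1] by auto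
next
  case False
  have ne: "x - y \<noteq> 0" "reflect i l x - y \<noteq> 0" "reflect j 0 x - y \<noteq> 0"
     "reflect i l (reflect j 0 x) - y \<noteq> 0" if "x \<in> A" "y \<in> B" for x y
    using that assms reflect_notin_Q[of x] by (auto simp: Q_def subset_iff)
  have "continuous_on (A \<times> B) (\<lambda>p. K (fst p) (snd p))"
    unfolding K_def using ne
    by (intro continuous_intros continuous_on_compose2[OF continuous_on_kern]) auto
  then obtain p where p: "p \<in> A \<times> B" "\<And>q. q \<in> A \<times> B \<Longrightarrow> K (fst p) (snd p) \<le> K (fst q) (snd q)"
    using continuous_attains_inf[OF compact_Times[OF assms(1,2)] False] by blast
  have "0 < K (fst p) (snd p)" using p(1) assms(3-5) by (intro K_pos) auto
  then show thesis using that p(2) by fastforce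
qed

end

context antisymmetric_solution
begin

text \<open>Suppose w_l > 0 at x. Subtracting \<tau> times an odd bump at x0 makes w_l negative near
  x0 only. Up to the integral of v, the Lipschitz term and the curvature of the bump cost \<tau> d,
  while the interaction with a ball around x gains \<open>a\<close>, which is independent of
  \<tau>.\<close>

lemma strong_maximum_principle:
  assumes l: "0 \<le> l" and w0: "\<And>x. x \<in> Q l \<Longrightarrow> 0 \<le> w l x"
    and x0: "x0 \<in> Q l" "x0 \<in> \<Omega>" "w l x0 = 0" and x: "x \<in> Q l"
  shows "w l x = 0"
proof (rule ccontr)
  assume "w l x \<noteq> 0"
  then have wx: "0 < w l x" using w0[OF x] by simp
  then have xx0: "x \<noteq> x0" using x0 by auto
  interpret D: double_reflection i1 iN l s by (rule double_reflection)
  have "open (\<Omega> \<inter> Q l)" using \<Omega>(1) D.open_Q by blast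
  then obtain e where e: "0 < e" "cball x0 e \<subseteq> \<Omega> \<inter> Q l"
    using x0 by (metis Int_iff open_contains_cball)
  \<comment> \<open>The doubled ball must stay in \<Omega> and Q for the second difference bound,
    which also asks for r \<le> 1, and \<open>x\<close> must lie outside the closed ball.\<close>
  define r where "r = Min {1, e / 2, dist x0 x / 2}"
  have r0: "0 < r" using e xx0 by (simp add: r_def)
  have "r \<le> 1" "r \<le> e / 2" "r \<le> dist x0 x / 2" unfolding r_def by (intro Min_le; simp)+
  moreover have "0 < dist x0 x" using xx0 by simp
  ultimately have r: "0 < r" "r \<le> 1" "2 * r \<le> e" "r < dist x0 x" using r0 by linarith+
  have cb: "cball x0 (2 * r) \<subseteq> \<Omega> \<inter> Q l" using e(2) r(3) by (meson order_trans subset_cball)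
  then have cb1: "cball x0 r \<subseteq> \<Omega>" "cball x0 r \<subseteq> Q l" "ball x0 r \<subseteq> Q l"
    using r subset_cball[of r "2 * r" x0] ball_subset_cball[of x0 r] by auto
  define m where "m = w l x / 2"
  have m: "0 < m" using wx by (simp add: m_def)
  have "open ({y. m < w l y} \<inter> Q l \<inter> - cball x0 r)"
    using open_Collect_less[OF continuous_on_const w_cont, of m l] D.open_Q by blast
  moreover have "x \<in> {y. m < w l y} \<inter> Q l \<inter> - cball x0 r" using x wx r by (simp add: m_def)
  ultimately obtain \<rho> where \<rho>: "0 < \<rho>" "cball x \<rho> \<subseteq> {y. m < w l y} \<inter> Q l \<inter> - cball x0 r"
    by (metis open_contains_cball)
  define B where "B = cball x \<rho>"
  have B: "compact B" "B \<subseteq> Q l" "B \<inter> cball x0 r = {}" "\<And>y. y \<in> B \<Longrightarrow> m < w l y"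
    using \<rho> by (auto simp: B_def)
  obtain k where k: "0 < k" "\<And>x y. x \<in> B \<Longrightarrow> y \<in> cball x0 r \<Longrightarrow> k \<le> D.K x y"
    using D.K_lower_bound[OF B(1) compact_cball B(2) cb1(2) B(3)] by blast
  have Bpos: "0 < measure lborel B"
    using content_cball[of \<rho> x] \<rho>(1) by (simp add: B_def)
  define \<Phi> where "\<Phi> = D.odd_bump r x0"
  have \<Phi>E: "\<Phi> \<in> energy_space s" unfolding \<Phi>_def using s r by (intro D.odd_bump_energy_space)
  have \<Phi>Q: "\<Phi> y = bump r x0 y" if "y \<in> Q l" for y
    unfolding \<Phi>_def using D.odd_bump_eq[OF r(1) cb1(3) that] .
  define I where "I = (\<integral>h. levy s h \<partial>(lborel :: (real ^ 'n) measure))"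
  have I0: "0 \<le> I" unfolding I_def by (rule Bochner_Integration.integral_nonneg) simp
  define a where "a = c * (m * k * measure lborel B / 2)"
  have a: "0 < a" using c_pos m k Bpos by (simp add: a_def)
  define d where "d = L + c * (16 / r\<^sup>2 * I)"
  have d: "0 < d" using L_pos c_pos I0 by (simp add: d_def add_pos_nonneg)
  \<comment> \<open>Half the value at which cost and gain would balance.\<close>
  define \<tau> where "\<tau> = a / (2 * d)"
  have \<tau>: "0 < \<tau>" using a d by (simp add: \<tau>_def)
  define W where "W y = w l y - \<tau> * \<Phi> y" for y
  have WE: "W \<in> energy_space s"
    unfolding W_def[abs_def] by (intro energy_space_diff w_energy energy_space_scale \<Phi>E)
  have Wodd: "D.odd2 W"
    using w_odd2[of l] D.odd_bump_odd2[of r x0] by (auto simp: D.odd2_def W_def \<Phi>_def algebra_simps)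
  have Wc: "continuous_on UNIV W"
    unfolding W_def \<Phi>_def by (intro continuous_intros w_cont D.odd_bump_cont r)
  \<comment> \<open>The shift can be 0 here: w_l \<ge> 0 on Q and the bump vanishes outside a ball,
    so the support is already contained in a compact subset of \<Omega>.\<close>
  define v where "v = D.neg 0 W"
  have vE: "v \<in> energy_space s" unfolding v_def by (rule D.neg_energy_space[OF Wodd WE order_refl])
  have v0: "0 \<le> v y" for y by (simp add: v_def)
  have vb: "norm (y - x0) < r" "v y \<le> \<tau>" "w l y \<le> \<tau>" if "v y \<noteq> 0" for y
  proof -
    have y: "y \<in> Q l" and vy: "v y = \<tau> * bump r x0 y - w l y" "w l y < \<tau> * bump r x0 y"
      using that \<Phi>Q[of y] by (auto simp: v_def D.neg_def W_def max_def split: if_splits)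
    have "bump r x0 y \<noteq> 0" using vy(2) w0[OF y] by auto
    then show "norm (y - x0) < r" using bump_eq_0[OF r(1)] not_le by blast
    have "\<tau> * bump r x0 y \<le> \<tau>" using bump_bounds[OF r(1), of x0 y] \<tau> by simp
    then show "v y \<le> \<tau>" "w l y \<le> \<tau>" using vy w0[OF y] by auto
  qed
  have v\<tau>: "v y \<le> \<tau>" for y using vb[of y] \<tau> by (cases "v y = 0") auto
  have vK: "y \<in> cball x0 r" if "v y \<noteq> 0" for y
    using vb(1)[OF that] by (simp add: dist_norm norm_minus_commute)
  have v\<tau>': "\<bar>v y\<bar> \<le> \<tau>" for y using v0[of y] v\<tau>[of y] by simp
  have vi: "integrable lborel v"
    using vE v\<tau>' vK by (intro compact_support_integrable[OF compact_cball]) auto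
  have lx: "l \<le> y $ i1" if "y \<in> cball x0 r" for y using cb1(2) that by (auto simp: D.Q_def)
  note wf = w_form_ge[OF l vE v0 v\<tau> compact_cball cb1(1) lx vK]
  have "(\<integral>y. \<bar>w l y\<bar> * v y \<partial>lborel) \<le> (\<integral>y. \<tau> * v y \<partial>lborel)"
  proof (rule integral_mono[OF wf(1)])
    show "integrable lborel (\<lambda>y. \<tau> * v y)" using vi by simp
    fix y
    show "\<bar>w l y\<bar> * v y \<le> \<tau> * v y"
    proof (cases "v y = 0")
      case False
      then have "y \<in> Q l" by (auto simp: v_def D.neg_def split: if_splits)
      then have "\<bar>w l y\<bar> \<le> \<tau>" using vb(3)[OF False] w0[of y] by simp
      then show ?thesis using v0 by (intro mult_right_mono)
    qed simp
  qed
  then have "L * (\<integral>y. \<bar>w l y\<bar> * v y \<partial>lborel) \<le> L * (\<tau> * (\<integral>y. v y \<partial>lborel))"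
    using L_pos by (intro mult_left_mono) auto
  then have 1: "- (L * \<tau> * (\<integral>y. v y \<partial>lborel)) \<le> c * frac_bilin s (w l) v"
    using wf(2) by (simp add: mult.assoc)
  have 2: "frac_bilin s \<Phi> v \<le> 16 / r\<^sup>2 * I * (\<integral>y. v y \<partial>lborel)"
    unfolding I_def
  proof (rule frac_bilin_le_second_difference[OF s \<Phi>E _ vE v0 vi])
    show "\<bar>\<Phi> y\<bar> \<le> 4" for y unfolding \<Phi>_def by (rule D.odd_bump_abs_le[OF r(1)])
    show "2 * \<Phi> y - \<Phi> (y + h) - \<Phi> (y - h) \<le> 16 / r\<^sup>2 * min 1 ((norm h)\<^sup>2)" if "v y \<noteq> 0" for y h
      unfolding \<Phi>_def using cb vb(1)[OF that] by (intro D.odd_bump_second_difference r) auto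
  qed simp
  have Bfin: "emeasure lborel B < \<infinity>" using emeasure_compact_finite[OF B(1)] by simp
  have kb: "m * k \<le> max 0 (W y) * D.K y z" if "y \<in> B" "D.neg 0 W z \<noteq> 0" for y z
  proof -
    have "y \<notin> cball x0 r" using B(3) that by blast
    then have "bump r x0 y = 0" by (intro bump_eq_0[OF r(1)]) (simp add: dist_norm norm_minus_commute)
    then have "\<Phi> y = 0" using \<Phi>Q[of y] B(2) that by auto
    then have "m \<le> max 0 (W y)" using B(4)[OF that(1)] by (simp add: W_def)
    moreover have "k \<le> D.K y z" using k(2) that vK by (simp add: v_def)
    ultimately show ?thesis using m k(1) by (intro mult_mono) auto
  qed
  have "frac_bilin s W v \<le> - frac_bilin s v v - m * k * measure lborel B / 2 * (\<integral>y. v y \<partial>lborel)"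
    using D.frac_bilin_neg_le[OF Wodd order_refl WE vi[unfolded v_def] _ Bfin B(2) _ kb] m k B(1)
    by (simp add: v_def borel_compact)
  also have "\<dots> \<le> - (m * k * measure lborel B / 2 * (\<integral>y. v y \<partial>lborel))"
    using frac_bilin_self_nonneg[of s v] by simp
  finally have "c * frac_bilin s W v \<le> c * - (m * k * measure lborel B / 2 * (\<integral>y. v y \<partial>lborel))"
    using c_pos by (intro mult_left_mono) auto
  then have 3: "c * frac_bilin s W v \<le> - (a * (\<integral>y. v y \<partial>lborel))"
    by (simp add: a_def mult.assoc)
  have "frac_bilin s W v = frac_bilin s (w l) v - \<tau> * frac_bilin s \<Phi> v"
    unfolding W_def[abs_def] frac_bilin_diff_left[OF w_energy energy_space_scale[OF \<Phi>E] vE]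
    by (simp add: frac_bilin_scale_left)
  then have "c * frac_bilin s W v = c * frac_bilin s (w l) v - c * \<tau> * frac_bilin s \<Phi> v"
    by (simp add: right_diff_distrib)
  moreover have "c * \<tau> * frac_bilin s \<Phi> v \<le> c * \<tau> * (16 / r\<^sup>2 * I * (\<integral>y. v y \<partial>lborel))"
    using 2 c_pos \<tau> by (intro mult_left_mono) auto
  ultimately have "a * (\<integral>y. v y \<partial>lborel) \<le> L * \<tau> * (\<integral>y. v y \<partial>lborel) + c * \<tau> * (16 / r\<^sup>2 * I * (\<integral>y. v y \<partial>lborel))"
    using 1 3 by linarith
  also have "\<dots> = \<tau> * d * (\<integral>y. v y \<partial>lborel)" by (simp add: d_def algebra_simps)
  also have "\<tau> * d = a / 2" using d by (simp add: \<tau>_def)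
  finally have 4: "a * (\<integral>y. v y \<partial>lborel) \<le> a / 2 * (\<integral>y. v y \<partial>lborel)" .
  have "0 < (\<integral>y. v y \<partial>lborel)"
  proof -
    define U where "U = Q l \<inter> {y. W y < - \<tau> / 2}"
    have "open U" unfolding U_def using D.open_Q open_Collect_less[OF Wc continuous_on_const] by blast
    moreover have "x0 \<in> U" using x0 \<tau> r \<Phi>Q[OF x0(1)] by (simp add: U_def W_def)
    moreover have Uv: "\<tau> / 2 \<le> v y" if "y \<in> U" for y using that \<tau> by (auto simp: U_def v_def D.neg_def)
    have Uc: "U \<subseteq> cball x0 r"
    proof
      fix y assume "y \<in> U"
      then have "v y \<noteq> 0" using Uv[of y] \<tau> by auto
      then show "y \<in> cball x0 r" by (rule vK)
    qed
    then have Ufin: "emeasure lborel U < \<infinity>"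
      using emeasure_bounded_finite[OF bounded_subset[OF bounded_cball Uc]] by simp
    ultimately have "0 < measure lborel U" by (intro measure_lborel_open_pos) auto
    then have "0 < (\<integral>y. \<tau> / 2 * indicator U y \<partial>lborel)" using \<tau> by simp
    also have "\<dots> \<le> (\<integral>y. v y \<partial>lborel)"
    proof (rule integral_mono[OF _ vi])
      show "integrable lborel (\<lambda>y. \<tau> / 2 * indicator U y)" using \<open>open U\<close> Ufin by (intro integrable_mult_right) auto
      show "\<tau> / 2 * indicator U y \<le> v y" for y using Uv[of y] v0[of y] by (cases "y \<in> U") auto
    qed
    finally show ?thesis .
  qed
  then show False using 4 a by simp
qed

end

section \<open>Moving planes\<close>

context antisymmetric_solution
begin

lemma w_tendsto: "((\<lambda>l. w l x) \<longlongrightarrow> w l0 x) (at l0 within S)"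
proof -
  have "((\<lambda>l. reflect i1 l x) \<longlongrightarrow> reflect i1 l0 x) (at l0 within S)"
    unfolding reflect_def by (intro tendsto_intros)
  moreover have "isCont u (reflect i1 l0 x)" using u_cont by (simp add: continuous_on_eq_continuous_at)
  ultimately show ?thesis
    unfolding w_def by (intro tendsto_diff tendsto_const isCont_tendsto_compose[of _ u])
qed

lemma negative_set: "{x \<in> Q l. w l x < 0} \<subseteq> \<Omega>"
  using w_outside[of _ l] by (force simp: Q_def)

text \<open>By dominated convergence the measure of the negative set tends to 0 as the planes
  approach \<open>l0\<close> from the left; once below the threshold of the weak maximum principle,
  the negative set is empty. If no point of \<Omega> lies in \<open>Q l0\<close>, the assumption is
  vacuous, which provides a starting position.\<close>

lemma continuation:
  assumes pos: "\<And>x. x \<in> \<Omega> \<Longrightarrow> x \<in> Q l0 \<Longrightarrow> 0 < w l0 x"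
  obtains e where "0 < e" "\<And>l x. 0 \<le> l \<Longrightarrow> l0 - e < l \<Longrightarrow> l \<le> l0 \<Longrightarrow> x \<in> Q l \<Longrightarrow> 0 \<le> w l x"
proof (rule ccontr)
  note obt = that
  assume neg: "\<not> thesis"
  have *: "\<exists>l. 0 \<le> l \<and> l0 - e < l \<and> l \<le> l0 \<and> \<not> (\<forall>x\<in>Q l. 0 \<le> w l x)" if e: "0 < e" for e
  proof (rule ccontr)
    assume "\<not> ?thesis"
    then have "0 \<le> w l x" if "0 \<le> l" "l0 - e < l" "l \<le> l0" "x \<in> Q l" for l x using that by blast
    from obt[OF e this] show False using neg by blast
  qed
  obtain \<delta> where \<delta>: "0 < \<delta>"
    "\<And>l. 0 \<le> l \<Longrightarrow> emeasure lborel {x \<in> Q l. w l x < 0} \<le> ennreal \<delta> \<Longrightarrow> \<forall>x\<in>Q l. 0 \<le> w l x"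
    using weak_maximum_principle by blast
  have "\<forall>n. \<exists>l. 0 \<le> l \<and> l0 - 1 / real (Suc n) < l \<and> l \<le> l0 \<and> \<not> (\<forall>x\<in>Q l. 0 \<le> w l x)"
    by (intro allI *) simp
  then obtain l where l: "\<And>n. 0 \<le> l n" "\<And>n. l0 - 1 / real (Suc n) < l n" "\<And>n. l n \<le> l0"
    "\<And>n. \<not> (\<forall>x\<in>Q (l n). 0 \<le> w (l n) x)"
    by metis
  have ll: "l \<longlonglongrightarrow> l0"
  proof (rule tendsto_sandwich[of "\<lambda>n. l0 - 1 / real (Suc n)" _ _ "\<lambda>n. l0"])
    have "(\<lambda>n. l0 - 1 / real (Suc n)) \<longlonglongrightarrow> l0 - 0"
      by (intro tendsto_diff tendsto_const lim_1_over_n[THEN LIMSEQ_Suc])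
    then show "(\<lambda>n. l0 - 1 / real (Suc n)) \<longlonglongrightarrow> l0" by simp
  qed (use l(2,3) in \<open>auto intro!: always_eventually less_imp_le\<close>)
  define A where "A n = {x \<in> Q (l n). w (l n) x < 0}" for n
  have Qb [measurable]: "Q m \<in> sets borel" for m
    using double_reflection.Q_borel[OF double_reflection] .
  have [measurable]: "A n \<in> sets borel" for n unfolding A_def by measurable
  have \<Omega>b [measurable]: "\<Omega> \<in> sets borel" using \<Omega> by simp
  have A\<Omega>: "A n \<subseteq> \<Omega>" for n unfolding A_def by (rule negative_set)
  have \<Omega>fin: "emeasure lborel \<Omega> < \<infinity>" using emeasure_bounded_finite[OF \<Omega>(2)] by simp
  have Afin: "emeasure lborel (A n) < \<infinity>" for n
    using emeasure_mono[OF A\<Omega>[of n], of lborel] \<Omega>fin by (simp add: order_le_less_trans)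
  have "(\<lambda>n. \<integral>x. indicator (A n) x \<partial>lborel) \<longlonglongrightarrow> (\<integral>x. (0 :: real) \<partial>(lborel :: (real ^ 'n) measure))"
  proof (rule integral_dominated_convergence)
    show "integrable lborel (indicator \<Omega> :: real ^ 'n \<Rightarrow> real)" using \<Omega>fin by simp
    show "AE x in lborel. norm (indicator (A n) x :: real) \<le> indicator \<Omega> x" for n
      using A\<Omega>[of n] by (auto simp: indicator_def)
    \<comment> \<open>On the limit plane w is 0 while its points may belong to \<open>A n\<close>
      for every n, so convergence can fail there; the plane is a null set.\<close>
    have "negligible {x :: real ^ 'n. x $ i1 = l0}"
      using negligible_standard_hyperplane[of "axis i1 1 :: real ^ 'n" l0]
      by (simp add: axis_in_Basis_iff cart_eq_inner_axis)
    then have "{x :: real ^ 'n. x $ i1 = l0} \<in> null_sets lborel"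
      using negligible_iff_null_sets[of "{x :: real ^ 'n. x $ i1 = l0}"]
      by (auto simp: null_sets_completion_iff null_sets_def)
    then have "AE x in lborel. x \<notin> {x :: real ^ 'n. x $ i1 = l0}" by (rule AE_not_in)
    then show "AE x in lborel. (\<lambda>n. indicator (A n) x :: real) \<longlonglongrightarrow> 0"
    proof eventually_elim
      fix x :: "real ^ 'n" assume x: "x \<notin> {x. x $ i1 = l0}"
      have "\<forall>\<^sub>F n in sequentially. x \<notin> A n"
      proof (cases "x $ i1 < l0 \<or> x $ iN \<le> 0 \<or> x \<notin> \<Omega>")
        case True
        then consider "x $ i1 < l0" | "x $ iN \<le> 0" | "x \<notin> \<Omega>" by blast
        then show ?thesis
        proof cases
          case 1
          then have "\<forall>\<^sub>F n in sequentially. x $ i1 < l n" by (rule order_tendstoD(1)[OF ll])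
          then show ?thesis by eventually_elim (auto simp: A_def Q_def)
        next
          case 2
          then show ?thesis by (simp add: A_def Q_def)
        next
          case 3
          then show ?thesis using A\<Omega> by (intro always_eventually) blast
        qed
      next
        case False
        then have "x \<in> Q l0" "x \<in> \<Omega>" using x by (auto simp: Q_def)
        then have "0 < w l0 x" using pos by blast
        moreover have "isCont (\<lambda>l. w l x) l0" unfolding isCont_def by (rule w_tendsto)
        then have "(\<lambda>n. w (l n) x) \<longlonglongrightarrow> w l0 x" using ll by (rule isCont_tendsto_compose)
        ultimately have "\<forall>\<^sub>F n in sequentially. 0 < w (l n) x" by (intro order_tendstoD(1))
        then show ?thesis by eventually_elim (auto simp: A_def)
      qed
      then have "\<forall>\<^sub>F n in sequentially. indicator (A n) x = (0 :: real)" by eventually_elim simp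
      then show "(\<lambda>n. indicator (A n) x :: real) \<longlonglongrightarrow> 0" by (rule tendsto_eventually)
    qed
  qed measurable
  then have "(\<lambda>n. measure lborel (A n)) \<longlonglongrightarrow> 0" by simp
  then have "\<forall>\<^sub>F n in sequentially. measure lborel (A n) < \<delta>" using \<delta>(1) by (intro order_tendstoD(2))
  then obtain n where n: "measure lborel (A n) < \<delta>" using eventually_happens[of _ sequentially] by auto
  have "emeasure lborel (A n) = ennreal (measure lborel (A n))"
    using Afin[of n] by (intro emeasure_eq_ennreal_measure) auto
  then have "emeasure lborel (A n) \<le> ennreal \<delta>" using n by (simp add: ennreal_leI)
  then show False using \<delta>(2)[OF l(1)] l(4)[of n] unfolding A_def by blast
qed

lemma reflect_symmetric:
  assumes "\<And>x. x \<in> Q l \<Longrightarrow> w l x = 0"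
  shows "u (reflect i1 l x) = u x"
proof -
  interpret D: double_reflection i1 iN l s by (rule double_reflection)
  note odd = D.odd2D[OF w_odd2]
  define x1 where "x1 = (if x $ i1 < l then reflect i1 l x else x)"
  define x2 where "x2 = (if x1 $ iN < 0 then reflect iN 0 x1 else x1)"
  have "l \<le> x2 $ i1" "0 \<le> x2 $ iN" using i1N by (auto simp: x1_def x2_def reflect_nth)
  then have "w l x2 = 0"
    using assms[of x2] D.odd2_zero[OF w_odd2, of x2] by (auto simp: Q_def order_le_less)
  then have "w l x = 0" using odd by (auto simp: x1_def x2_def split: if_splits)
  then show ?thesis by (simp add: w_def)
qed

text \<open>The reflection in x_1 = 0 is the scaling with t = -1 and maps \<Omega> onto itself.
  Monotonicity of f, applied at x and at its image, gives equality, so the equation is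
  invariant.\<close>

lemma antisymmetric_solution_reflect: "antisymmetric_solution s i1 iN \<Omega> f (\<lambda>x. u (reflect i1 0 x))"
proof
  have m1: "reflect i1 0 x = scale_coord i1 (-1) x" for x :: "real ^ 'n"
    by (simp add: vec_eq_iff reflect_nth scale_coord_def)
  have \<Omega>r: "reflect i1 0 x \<in> \<Omega>" if "x \<in> \<Omega>" for x
  proof -
    have "scale_coord iN 1 x = x" by (simp add: scale_coord_def vec_eq_iff)
    then show ?thesis using \<Omega>_scale[OF that, of "-1" 1] by (simp add: m1)
  qed
  have \<Omega>r_iff: "reflect i1 0 x \<in> \<Omega> \<longleftrightarrow> x \<in> \<Omega>" for x
    using \<Omega>r[of x] \<Omega>r[of "reflect i1 0 x"] by auto
  have fr: "f (reflect i1 0 x) a = f x a" if "x \<in> \<Omega>" for x a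
    using f_mono[OF that, of "-1" a] f_mono[OF \<Omega>r[OF that], of "-1" a] by (simp flip: m1)
  show "continuous_on UNIV (\<lambda>x. u (reflect i1 0 x))"
    by (intro continuous_on_compose2[OF u_cont] continuous_intros) auto
  show "bounded (range (\<lambda>x. u (reflect i1 0 x)))"
    by (rule bounded_subset[OF u_bdd]) auto
  show "antisymmetric_wrt iN 0 (\<lambda>x. u (reflect i1 0 x))"
    by (simp add: antisymmetric_wrt_def fun_eq_iff reflect_commute[OF i1N] u_reflect_N)
  show "0 \<le> u (reflect i1 0 x)" if "x \<in> half_space iN 0 \<inter> \<Omega>" for x
    using that i1N by (intro u_ge_0) (auto simp: half_space_def reflect_nth)
  show "compact_weak_solution s \<Omega> f (\<lambda>x. u (reflect i1 0 x))"
    unfolding compact_weak_solution_def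
  proof (intro conjI ballI impI allI)
    show "(\<lambda>x. u (reflect i1 0 x)) \<in> energy_space s" by (rule energy_space_reflect[OF u_energy])
    show "u (reflect i1 0 x) = 0" if "x \<notin> \<Omega>" for x using that by (simp add: u_outside \<Omega>r_iff)
    fix v :: "real ^ 'n \<Rightarrow> real" and K
    assume v: "v \<in> energy_space s" "bounded (range v)" and K: "compact K" "K \<subseteq> \<Omega>" "\<forall>x. v x \<noteq> 0 \<longrightarrow> x \<in> K"
    have [measurable]: "v \<in> borel_measurable borel" using v by auto
    define v' where "v' x = v (reflect i1 0 x)" for x
    have v'[measurable]: "v' \<in> borel_measurable borel" unfolding v'_def by measurable
    obtain C where C: "\<And>x. \<bar>v x\<bar> \<le> C" using v(2) by (auto simp: bounded_iff)
    have "c * frac_bilin s u v' = (\<integral>x. F x * v' x \<partial>lborel)"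
    proof (rule weak_form(2))
      show "v' \<in> energy_space s" unfolding v'_def[abs_def] by (rule energy_space_reflect[OF v(1)])
      show "\<bar>v' x\<bar> \<le> C" for x by (simp add: v'_def C)
      show "compact (reflect i1 0 ` K)" using K(1) by (intro compact_continuous_image continuous_intros)
      show "reflect i1 0 ` K \<subseteq> \<Omega>" using K(2) \<Omega>r by auto
      show "x \<in> reflect i1 0 ` K" if "v' x \<noteq> 0" for x
        using K(3) that by (intro image_eqI[of _ _ "reflect i1 0 x"]) (auto simp: v'_def)
    qed
    also have "\<dots> = (\<integral>x. F (reflect i1 0 x) * v' (reflect i1 0 x) \<partial>lborel)"
      by (rule integral_lborel_reflect(1)[symmetric]) measurable
    also have "\<dots> = (\<integral>x. indicator \<Omega> x * f x (u (reflect i1 0 x)) * v x \<partial>lborel)"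
    proof (intro Bochner_Integration.integral_cong refl)
      fix x
      show "F (reflect i1 0 x) * v' (reflect i1 0 x) = indicator \<Omega> x * f x (u (reflect i1 0 x)) * v x"
        by (cases "x \<in> \<Omega>") (simp_all add: F_def v'_def \<Omega>r_iff fr)
    qed
    also have "frac_bilin s u v' = frac_bilin s (\<lambda>x. u (reflect i1 0 x)) v"
      unfolding v'_def[abs_def] by (rule frac_bilin_reflect[symmetric]) measurable
    finally show "frac_const CARD('n) s / 2 * frac_bilin s (\<lambda>x. u (reflect i1 0 x)) v
      = (\<integral>x. indicator \<Omega> x * f x (u (reflect i1 0 x)) * v x \<partial>lborel)"
      by (simp add: c_def)
  qed
qed (use s i1N \<Omega> \<Omega>_scale f_cont f_lip f_mono in blast)+

text \<open>If \<open>u\<close> were symmetric about a plane at \<open>l > 0\<close>, it would vanish near the far left end of \<open>\<Omega>\<close>.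
  Moving planes in from that side, the strong maximum principle produces a second plane of symmetry,
  and two parallel planes make \<open>u\<close> periodic.\<close>

lemma not_symmetric:
  assumes l: "0 < l" and sym: "\<And>x. u (reflect i1 l x) = u x"
  shows "u z = 0"
proof (rule ccontr)
  assume uz: "u z \<noteq> 0"
  interpret T: antisymmetric_solution s i1 iN \<Omega> f "\<lambda>x. u (reflect i1 0 x)" by (rule antisymmetric_solution_reflect)
  have id: "scale_coord i 1 x = x" for i and x :: "real ^ 'n" by (simp add: scale_coord_def vec_eq_iff)
  define E where "E = {x \<in> \<Omega>. 0 < x $ iN}"
  have uE: "x \<in> E" if "u x \<noteq> 0" "0 < x $ iN" for x using that u_outside[of x] by (auto simp: E_def)
  obtain z' where z': "z' \<in> E"
  proof (cases "0 < z $ iN")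
    case True
    then show thesis using that uE uz by blast
  next
    case False
    moreover have "z $ iN \<noteq> 0"
    proof
      assume "z $ iN = 0"
      then have "reflect iN 0 z = z" by (simp add: vec_eq_iff reflect_nth)
      then show False using u_reflect_N[of z] uz by simp
    qed
    ultimately show thesis using that[OF uE[of "reflect iN 0 z"]] uz by (simp add: u_reflect_N reflect_nth)
  qed
  define S where "S = (\<lambda>x. x $ i1) ` E"
  have "bounded S"
    unfolding S_def using \<Omega>(2) by (intro bounded_component_cart bounded_subset[OF \<Omega>(2)]) (auto simp: E_def)
  then have bdd: "bdd_above S" by (rule bounded_imp_bdd_above)
  define a where "a = Sup S"
  have less_a: "x $ i1 < a" if xE: "x \<in> E" for x
  proof -
    have "open E"
    proof -
      have "E = \<Omega> \<inter> {x. 0 < x $ iN}" by (auto simp: E_def)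
      then show ?thesis using \<Omega>(1) by (auto intro!: open_Int open_Collect_less continuous_intros)
    qed
    then obtain e where e: "0 < e" "cball x e \<subseteq> E" using xE open_contains_cball by blast
    have "x + e *\<^sub>R axis i1 1 \<in> E" using e by (intro subsetD[OF e(2)]) (simp add: dist_norm)
    then have "(x + e *\<^sub>R axis i1 1) $ i1 \<in> S" unfolding S_def by (rule imageI)
    then have "(x + e *\<^sub>R axis i1 1) $ i1 \<le> a" unfolding a_def using bdd by (rule cSup_upper)
    then show ?thesis using e by (simp add: axis_def)
  qed
  \<comment> \<open>A point with first coordinate 0 belongs to E and lies strictly left of a, so a >
    0.\<close>
  have "scale_coord i1 0 z' \<in> E"
    using z' \<Omega>_scale[of z' 0 1] i1N by (auto simp: E_def id) (simp add: scale_coord_def)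
  from less_a[OF this] have a: "0 < a" by (simp add: scale_coord_def)
  \<comment> \<open>Vacuous: no point of \<Omega> with x_N > 0 lies to the right of a.\<close>
  have "0 < T.w a x" if "x \<in> \<Omega>" "x \<in> Q a" for x
    using less_a[of x] that by (auto simp: Q_def E_def)
  then obtain e where e: "0 < e" "\<And>m x. 0 \<le> m \<Longrightarrow> a - e < m \<Longrightarrow> m \<le> a \<Longrightarrow> x \<in> Q m \<Longrightarrow> 0 \<le> T.w m x"
    using T.continuation[of a] by metis
  define m where "m = a - min (e / 2) (min l a)"
  have m: "0 \<le> m" "a - e < m" "m < a" "a - l \<le> m" using e(1) a l by (auto simp: m_def)
  obtain x where x: "x \<in> E" "m < x $ i1"
    using m(3) less_cSup_iff[OF _ bdd, of m] z' by (auto simp: a_def S_def)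
  have zero: "u y = 0" if "0 < y $ iN" "a \<le> 2 * l - y $ i1" for y
  proof (rule ccontr)
    assume "u y \<noteq> 0"
    then have "reflect i1 l y \<in> E" using that i1N by (intro uE) (auto simp: sym reflect_nth)
    from less_a[OF this] show False using that by (simp add: reflect_nth)
  qed
  have xN: "0 < x $ iN" "x \<in> \<Omega>" using x by (auto simp: E_def)
  \<comment> \<open>In the upper half space the mirror image of u vanishes where the first
    coordinate is at least a - 2l. Both x and its reflection belong there, since 2m - x_1 > 2m - a
    \<ge> a - 2l by the choice of m.\<close>
  have "T.w m x = 0"
    using zero[of "reflect i1 0 x"] zero[of "reflect i1 0 (reflect i1 m x)"] xN x(2) less_a[OF x(1)] m i1N l
    by (simp add: T.w_def reflect_nth)
  then have "T.w m y = 0" if "y \<in> Q m" for y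
    using T.strong_maximum_principle[OF m(1) e(2)[OF m(1,2) less_imp_le[OF m(3)]] _ _ _ that, of x] x xN
    by (simp add: Q_def)
  then have symT: "u (reflect i1 0 (reflect i1 m y)) = u (reflect i1 0 y)" for y
    using T.reflect_symmetric by blast
  \<comment> \<open>u is symmetric about x_1 = l and about x_1 = -m; the two reflections compose to
    a translation by twice the distance of the planes.\<close>
  define d where "d = 2 * (l + m)"
  have shift: "u (y + d *\<^sub>R axis i1 1) = u y" for y
  proof -
    have "y + d *\<^sub>R axis i1 1 = reflect i1 l (reflect i1 0 (reflect i1 m (reflect i1 0 y)))"
      by (simp add: vec_eq_iff reflect_nth d_def axis_def)
    then show ?thesis by (simp add: sym symT)
  qed
  have shifts: "u (z + (real k * d) *\<^sub>R axis i1 1) = u z" for k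
  proof (induction k)
    case (Suc k)
    then show ?case using shift[of "z + (real k * d) *\<^sub>R axis i1 1"] by (simp add: algebra_simps)
  qed simp
  obtain R where R: "\<And>x. x \<in> \<Omega> \<Longrightarrow> norm x \<le> R" using \<Omega>(2) by (auto simp: bounded_iff)
  have "0 < d" using l m by (simp add: d_def)
  then obtain k where k: "norm z + R < real k * d" using ex_less_of_nat_mult by blast
  have "real k * d = norm ((z + (real k * d) *\<^sub>R axis i1 1) - z)"
    using \<open>0 < d\<close> by simp
  also have "\<dots> \<le> norm (z + (real k * d) *\<^sub>R axis i1 1) + norm z" by (rule norm_triangle_ineq4)
  finally have "z + (real k * d) *\<^sub>R axis i1 1 \<notin> \<Omega>" using R k by force
  then show False using shifts[of k] uz u_outside by simp
qed

text \<open>The infimum b of the good positions is itself good by continuity. If b > 0, the strong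
  maximum principle makes w_b positive on \<Omega> in Q, as a zero would give a plane of symmetry,
  impossible for nonzero u; the plane can then be moved further left.\<close>

lemma moving_planes:
  assumes nz: "u z \<noteq> 0" and l: "0 \<le> l"
  shows "\<forall>x\<in>Q l. 0 \<le> w l x"
proof -
  define S where "S = {l. 0 \<le> l \<and> (\<forall>m\<ge>l. \<forall>x\<in>Q m. 0 \<le> w m x)}"
  obtain R where R: "\<And>x. x \<in> \<Omega> \<Longrightarrow> norm x \<le> R" using \<Omega>(2) by (auto simp: bounded_iff)
  have "max 0 R \<in> S"
  proof -
    have "0 \<le> w m x" if "R \<le> m" "x \<in> Q m" for m x
    proof (rule w_outside)
      have "R < \<bar>x $ i1\<bar>" using that by (auto simp: Q_def)
      then show "x \<notin> \<Omega>" using R[of x] component_le_norm_cart[of x i1] by linarith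
    qed (use that in \<open>auto simp: Q_def\<close>)
    then show ?thesis by (auto simp: S_def)
  qed
  then have ne: "S \<noteq> {}" by blast
  have bdd: "bdd_below S" by (rule bdd_belowI[of _ 0]) (simp add: S_def)
  define b where "b = Inf S"
  have b0: "0 \<le> b" unfolding b_def using ne by (rule cInf_greatest) (simp add: S_def)
  have above: "0 \<le> w m x" if m: "b < m" "x \<in> Q m" for m x
  proof -
    obtain l' where "l' \<in> S" "l' < m" using m(1) cInf_less_iff[OF ne bdd] by (auto simp: b_def)
    then show ?thesis using m(2) by (simp add: S_def)
  qed
  have at: "0 \<le> w b x" if x: "x \<in> Q b" for x
  proof (rule tendsto_lowerbound[OF w_tendsto[of x b "{b<..}"]])
    have "b < x $ i1" using x by (simp add: Q_def)
    then have "\<forall>\<^sub>F m in at_right b. m \<in> {b<..<x $ i1}" by (rule eventually_at_right_real)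
    then show "\<forall>\<^sub>F m in at_right b. 0 \<le> w m x"
      by eventually_elim (use x in \<open>auto simp: Q_def intro!: above\<close>)
  qed simp
  have "b = 0"
  proof (rule ccontr)
    assume "b \<noteq> 0"
    then have b: "0 < b" using b0 by simp
    have "0 < w b x" if x: "x \<in> \<Omega>" "x \<in> Q b" for x
    proof (rule ccontr)
      assume "\<not> 0 < w b x"
      then have "w b x = 0" using at[OF x(2)] by simp
      then have "w b y = 0" if "y \<in> Q b" for y
        using strong_maximum_principle[OF b0 at x(2,1) _ that] by blast
      then have "u (reflect i1 b y) = u y" for y by (rule reflect_symmetric)
      from not_symmetric[OF b this] show False using nz by blast
    qed
    then obtain e where e: "0 < e" "\<And>m x. 0 \<le> m \<Longrightarrow> b - e < m \<Longrightarrow> m \<le> b \<Longrightarrow> x \<in> Q m \<Longrightarrow> 0 \<le> w m x"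
      using continuation[of b] by blast
    define m where "m = max 0 (b - e / 2)"
    have m: "0 \<le> m" "b - e < m" "m < b" using e(1) b by (auto simp: m_def)
    have "0 \<le> w m' x" if "m \<le> m'" "x \<in> Q m'" for m' x
    proof (cases "m' \<le> b")
      case True
      then show ?thesis using that m by (intro e(2)) auto
    qed (use above that in auto)
    then have "m \<in> S" using m by (auto simp: S_def)
    then have "b \<le> m" unfolding b_def using bdd by (rule cInf_lower)
    then show False using m by simp
  qed
  then show ?thesis using above at l by (cases "l = 0") auto
qed

lemma moving_planes_strict:
  assumes nz: "u z \<noteq> 0" and l: "0 < l" and x: "x \<in> \<Omega>" "x \<in> Q l"
  shows "0 < w l x"
proof (rule ccontr)
  have w0: "0 \<le> w l y" if "y \<in> Q l" for y using moving_planes[OF nz, of l] l that by simp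
  assume "\<not> 0 < w l x"
  then have "w l x = 0" using w0[OF x(2)] by simp
  then have "w l y = 0" if "y \<in> Q l" for y
    using strong_maximum_principle[OF less_imp_le[OF l] w0 x(2,1) _ that] by blast
  then have "u (reflect i1 l y) = u y" for y by (rule reflect_symmetric)
  from not_symmetric[OF l this] show False using nz by blast
qed

text \<open>At l = 0 the inequality for u and the one for its mirror image are opposite, so w_0 = 0
  on Q 0.\<close>

lemma symmetric: "u (reflect i1 0 x) = u x"
proof (cases "\<forall>z. u z = 0")
  case False
  then obtain z where z: "u z \<noteq> 0" by blast
  interpret T: antisymmetric_solution s i1 iN \<Omega> f "\<lambda>x. u (reflect i1 0 x)" by (rule antisymmetric_solution_reflect)
  have Tz: "u (reflect i1 0 (reflect i1 0 z)) \<noteq> 0" using z by simp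
  have "w 0 y = 0" if "y \<in> Q 0" for y
    using moving_planes[OF z order_refl] T.moving_planes[OF Tz order_refl] that
    by (force simp: w_def T.w_def)
  then show ?thesis by (rule reflect_symmetric)
qed simp

lemma strictly_decreasing:
  assumes nz: "u z \<noteq> 0" and xy: "x \<in> \<Omega>" "y \<in> \<Omega>" "0 < x $ i1" "0 < y $ iN"
    and eq: "\<forall>i. i \<noteq> i1 \<longrightarrow> x $ i = y $ i" and lt: "x $ i1 < y $ i1"
  shows "u y < u x"
proof -
  \<comment> \<open>The plane halfway between the two points reflects y to x.\<close>
  define l where "l = (x $ i1 + y $ i1) / 2"
  have l: "0 < l" "l < y $ i1" using xy lt by (auto simp: l_def)
  have "2 * l = x $ i1 + y $ i1" by (simp add: l_def)
  then have "reflect i1 l y = x" using eq by (auto simp: vec_eq_iff reflect_nth)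
  moreover have "0 < w l y" using xy l by (intro moving_planes_strict[OF nz]) (auto simp: Q_def)
  ultimately show ?thesis by (simp add: w_def)
qed

end

(* i1 and iN are the first and the last coordinate; N \<ge> 2 is the hypothesis i1 \<noteq> iN. *)
theorem theorem1p1:
  fixes s :: real
    and i1 iN :: "'n::finite"
    and \<Omega> :: "(real ^ 'n) set"
    and f :: "real ^ 'n \<Rightarrow> real \<Rightarrow> real"
    and u :: "real ^ 'n \<Rightarrow> real"
  assumes "0 < s" and "s < 1"
    and "i1 \<noteq> iN"
    and "open \<Omega>" and "bounded \<Omega>"
    and "\<And>x t \<tau>. x \<in> \<Omega> \<Longrightarrow> t \<in> {-1..1} \<Longrightarrow> \<tau> \<in> {-1..1} \<Longrightarrow>
           scale_coord i1 t (scale_coord iN \<tau> x) \<in> \<Omega>"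
    and "continuous_on (\<Omega> \<times> UNIV) (\<lambda>(x, a). f x a)"
    and "\<And>K :: real set. bounded K \<Longrightarrow>
           \<exists>L>0. \<forall>a\<in>K. \<forall>b\<in>K. \<forall>x\<in>\<Omega>. \<bar>f x a - f x b\<bar> \<le> L * \<bar>a - b\<bar>"
    and "\<And>a x t. x \<in> \<Omega> \<Longrightarrow> t \<in> {-1..1} \<Longrightarrow> f (scale_coord i1 t x) a \<ge> f x a"
    and "weak_solution s \<Omega> f u"
    and "continuous_on UNIV u" and "bounded (range u)"
    and "antisymmetric_wrt iN 0 u"
    and "\<And>x. x \<in> half_space iN 0 \<inter> \<Omega> \<Longrightarrow> u x \<ge> 0"
  shows "symmetric_wrt i1 0 u \<and>
    ((\<forall>x\<in>\<Omega>. u x = 0) \<or>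
     (\<forall>x \<in> \<Omega> \<inter> half_space i1 0 \<inter> half_space iN 0.
      \<forall>y \<in> \<Omega> \<inter> half_space i1 0 \<inter> half_space iN 0.
        (\<forall>i. i \<noteq> i1 \<longrightarrow> x $ i = y $ i) \<longrightarrow> x $ i1 < y $ i1 \<longrightarrow> u x > u y))"
proof -
  interpret antisymmetric_solution s i1 iN \<Omega> f u
    using assms(1-9) weak_solution_imp_compact[OF assms(4,7,11,10)] assms(11-14) by (rule antisymmetric_solution.intro)
  have "symmetric_wrt i1 0 u" by (simp add: symmetric_wrt_def fun_eq_iff symmetric)
  moreover have "u y < u x"
    if "z \<in> \<Omega>" "u z \<noteq> 0" "x \<in> \<Omega> \<inter> half_space i1 0 \<inter> half_space iN 0"
      "y \<in> \<Omega> \<inter> half_space i1 0 \<inter> half_space iN 0"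
      "\<forall>i. i \<noteq> i1 \<longrightarrow> x $ i = y $ i" "x $ i1 < y $ i1" for x y z
    using that by (intro strictly_decreasing[of z]) (auto simp: half_space_def)
  ultimately show ?thesis by blast
qed

end
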